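(* Let $H$ be a path or a cycle and let $W:[0,1]^2\to\mathbb{R}$ be a kernel. Then \[ t_{H}(W) +t_{H}(1-W) \geq t_{K_2}(W)^{e(H)} +t_{K_2}(1-W)^{e(H)}. \]
   Context: A kernel is a bounded symmetric measurable function $W:[0,1]^2\to\mathbb{R}$. For a graph $H$ and a kernel $W$, the homomorphism density is $t_H(W):=\int_{[0,1]^{V(H)}}\prod_{ij\in E(H)}W(x_i,x_j)\prod_{i\in V(H)}dx_i$ (Lebesgue measure). $e(H)$ is the number of edges of $H$, $K_2$ is the single edge, and $1-W$ denotes the kernel $(x,y)\mapsto 1-W(x,y)$. *)

theory Defs
  imports "HOL-Analysis.Analysis"
begin

record 'v ugraph =
  verts :: "'v set"
  edges :: "'v set set"

definition simple_graph :: "'v ugraph \<Rightarrow> bool" where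
  "simple_graph H \<longleftrightarrow> finite (verts H) \<and> (\<forall>e\<in>edges H. e \<subseteq> verts H \<and> card e = 2)"

text \<open>A graph is a path (a cycle) if its vertices can be listed without repetition so that the
  edges are exactly the pairs of consecutive (cyclically consecutive) vertices. The one-vertex
  path is allowed; cycles have at least three vertices.\<close>

definition path_graph :: "'v ugraph \<Rightarrow> bool" where
  "path_graph H \<longleftrightarrow> (\<exists>vs. vs \<noteq> [] \<and> distinct vs \<and> verts H = set vs \<and>
     edges H = {{vs ! i, vs ! Suc i} | i. Suc i < length vs})"

definition cycle_graph :: "'v ugraph \<Rightarrow> bool" where
  "cycle_graph H \<longleftrightarrow> (\<exists>vs. length vs \<ge> 3 \<and> distinct vs \<and> verts H = set vs \<and>
     edges H = {{vs ! i, vs ! (Suc i mod length vs)} | i. i < length vs})"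

definition K2 :: "nat ugraph" where
  "K2 = \<lparr>verts = {0, 1}, edges = {{0, 1}}\<rparr>"

text \<open>Kernels are total functions of which only the values on the unit square matter.
  Measurability is Lebesgue measurability, so every Borel kernel is included.\<close>

definition is_kernel :: "(real \<Rightarrow> real \<Rightarrow> real) \<Rightarrow> bool" where
  "is_kernel W \<longleftrightarrow>
     (\<exists>B. \<forall>x\<in>{0..1}. \<forall>y\<in>{0..1}. \<bar>W x y\<bar> \<le> B) \<and>
     (\<forall>x\<in>{0..1}. \<forall>y\<in>{0..1}. W x y = W y x) \<and>
     (\<lambda>(x, y). W x y) \<in> borel_measurable (lebesgue_on ({0..1} \<times> {0..1}))"

text \<open>The value of \<open>W (x i) (x j)\<close> on the unordered edge \<open>{i, j}\<close>; it does not depend on the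
  order of the end points when \<open>W\<close> is symmetric, see \<open>edge_value_doubleton\<close>.\<close>

definition edge_value :: "(real \<Rightarrow> real \<Rightarrow> real) \<Rightarrow> ('v \<Rightarrow> real) \<Rightarrow> 'v set \<Rightarrow> real" where
  "edge_value W x e = (THE w. \<exists>i j. e = {i, j} \<and> w = W (x i) (x j))"

text \<open>Lebesgue measure on the cube indexed by \<open>V\<close>. The completion is essential: for a Lebesgue
  measurable kernel the integrand of the homomorphism density need not be measurable with
  respect to the product sigma-algebra, and then its Bochner integral would be 0 by convention.\<close>

definition cube_measure :: "'v set \<Rightarrow> ('v \<Rightarrow> real) measure" where
  "cube_measure V = completion (PiM V (\<lambda>_. restrict_space lborel {0..1}))"

definition hom_density :: "'v ugraph \<Rightarrow> (real \<Rightarrow> real \<Rightarrow> real) \<Rightarrow> real" where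
  "hom_density H W = (\<integral>x. (\<Prod>e\<in>edges H. edge_value W x e) \<partial>cube_measure (verts H))"

lemma edge_value_doubleton:
  assumes "is_kernel W" "x i \<in> {0..1}" "x j \<in> {0..1}"
  shows "edge_value W x {i, j} = W (x i) (x j)"
proof -
  have sym: "W (x j) (x i) = W (x i) (x j)"
    using assms unfolding is_kernel_def by blast
  show ?thesis
    unfolding edge_value_def by (rule the_equality) (auto simp: doubleton_eq_iff sym)
qed

lemma path_graph_simple:
  assumes "path_graph H" shows "simple_graph H"
  using assms unfolding path_graph_def simple_graph_def
  by (fastforce simp: card_2_iff nth_eq_iff_index_eq)

lemma cycle_graph_simple:
  assumes "cycle_graph H" shows "simple_graph H"
proof -
  obtain vs where vs: "length vs \<ge> 3" "distinct vs" "verts H = set vs"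
      "edges H = {{vs ! i, vs ! (Suc i mod length vs)} | i. i < length vs}"
    using assms unfolding cycle_graph_def by blast
  have "vs ! i \<noteq> vs ! (Suc i mod length vs)" if "i < length vs" for i
  proof -
    have "Suc i mod length vs < length vs" "i \<noteq> Suc i mod length vs"
      using vs(1) that by (auto simp: mod_Suc)
    then show ?thesis
      using vs(2) that by (simp add: nth_eq_iff_index_eq)
  qed
  moreover have "vs ! (Suc i mod length vs) \<in> set vs" if "i < length vs" for i
    using that by (intro nth_mem mod_less_divisor) auto
  ultimately show ?thesis
    using vs unfolding simple_graph_def by auto
qed

end

theory Submission
  imports Defs "HOL-Probability.Probability"
begin

text \<open>Write \<open>W = 1/2 + U\<close>, so that \<open>1 - W = 1/2 - U\<close>, and let \<open>b\<^sub>j\<close> be the density of the walk with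
  \<open>j\<close> edges in \<open>U\<close>, with generating function \<open>B(z) = \<Sum> b\<^sub>j z\<^sup>j\<close>. Expanding the powers of \<open>\<alpha> J + U\<close>,
  where \<open>J\<close> is the rank-one kernel 1, the density of the path with \<open>k\<close> edges in \<open>\<alpha> + U\<close> is
  \<open>\<Sum> \<alpha>\<^sup>m [z\<^bsup>k-m\<^esup>] B\<^bsup>m+1\<^esup>\<close>, and that of the cycle of length \<open>k\<close> is
  \<open>tr U\<^sup>k + \<Sum> \<alpha>\<^sup>m (k/m) [z\<^bsup>k-m\<^esup>] B\<^sup>m\<close>. On adding the expressions for \<open>U\<close> and \<open>- U\<close> the odd
  coefficients cancel, and so do the traces of \<open>U\<^sup>k\<close> and \<open>(- U)\<^sup>k\<close> if \<open>k\<close> is odd. Since \<open>b\<close> is the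
  moment sequence of the spectral measure of \<open>U\<close> at the constant function 1, an even coefficient of
  \<open>B\<^sup>m\<close> is the expectation of a complete homogeneous symmetric polynomial of even degree in
  independent variables. These polynomials are convex in each variable, so by Jensen's inequality
  the coefficient is smallest for the constant kernel \<open>U = b\<^sub>1\<close>, which gives the right-hand side.
  For even cycles the density is at least that of the path with as many edges.\<close>

subsection \<open>Even complete homogeneous polynomials and moment sequences\<close>

text \<open>The series 1/(1 - y X), characterised without division by \<open>geom_eq\<close>, so
  that identities between such series become ring algebra.\<close>

definition geom :: "real \<Rightarrow> real fps" where
  "geom y = Abs_fps (\<lambda>n. y ^ n)"

lemma geom_nth [simp]: "fps_nth (geom y) n = y ^ n"
  by (simp add: geom_def)

lemma geom_eq: "geom y = 1 + fps_const y * fps_X * geom y"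
proof (rule fps_ext)
  fix n show "fps_nth (geom y) n = fps_nth (1 + fps_const y * fps_X * geom y) n"
    by (cases n) (simp_all add: mult.assoc)
qed

text \<open>Expand (1 - x X)(1 - y X) = (1 - (x + y) X) + x y X^2 and multiply by the three series.
  For opposite signs the factor - x y is nonnegative.\<close>

lemma geom_mult_geom:
  "geom x * geom y = geom (x + y)
     + fps_const (- (x * y)) * fps_X ^ 2 * (geom x * geom y * geom (x + y))"
proof -
  have c: "fps_const (x + y) = fps_const x + fps_const y"
    "fps_const (- (x * y)) = - (fps_const x * fps_const y)"
    by simp_all
  show ?thesis
    unfolding c using geom_eq[of x] geom_eq[of y] geom_eq[of "x + y", unfolded c]
    by algebra
qed

text \<open>First-order Taylor expansion in \<open>x\<close> at \<open>c\<close> with exact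
  remainder: the derivative of 1/(1 - x X) in \<open>x\<close> at \<open>c\<close> is X times
  \<open>geom c ^ 2\<close>.\<close>

lemma geom_tangent:
  "geom x = geom c + fps_const (x - c) * fps_X * geom c ^ 2
     + fps_const ((x - c)\<^sup>2) * fps_X ^ 2 * (geom x * geom c ^ 2)"
proof -
  have c: "fps_const (x - c) = fps_const x - fps_const c"
    "fps_const ((x - c)\<^sup>2) = (fps_const x - fps_const c)\<^sup>2"
    by (simp_all add: power2_eq_square)
  show ?thesis
    unfolding c using geom_eq[of x] geom_eq[of c] by algebra
qed

text \<open>The coefficient of index \<open>n\<close> is the complete homogeneous symmetric polynomial of degree
  \<open>n\<close> in the elements of the multiset.\<close>

definition homog :: "real multiset \<Rightarrow> real fps" where
  "homog A = (\<Prod>y\<in>#A. geom y)"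

lemma homog_simps [simp]:
  "homog {#} = 1" "homog (add_mset y A) = geom y * homog A"
  "homog (A + C) = homog A * homog C" "homog (replicate_mset m y) = geom y ^ m"
  by (simp_all add: homog_def image_replicate_mset)

text \<open>By homogeneity \<open>s ^ n\<close> is absorbed into the variables, and the polynomial
  has nonnegative coefficients.\<close>

lemma homog_same_sign:
  assumes "\<forall>y\<in>#A. s * y \<ge> 0"
  shows "s ^ n * fps_nth (homog A) n \<ge> 0"
  using assms
proof (induction A arbitrary: n)
  case empty
  then show ?case by simp
next
  case (add y A)
  have "s ^ n * fps_nth (homog (add_mset y A)) n
      = (\<Sum>i=0..n. (s * y) ^ i * (s ^ (n - i) * fps_nth (homog A) (n - i)))"
    unfolding homog_simps fps_mult_nth sum_distrib_left
    by (intro sum.cong) (auto simp: power_mult_distrib algebra_simps simp flip: power_add)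
  also have "\<dots> \<ge> 0"
  proof (intro sum_nonneg)
    fix i
    have "(s * y) ^ i \<ge> 0" using add.prems by simp
    moreover have "s ^ (n - i) * fps_nth (homog A) (n - i) \<ge> 0"
      using add by auto
    ultimately show "(s * y) ^ i * (s ^ (n - i) * fps_nth (homog A) (n - i)) \<ge> 0"
      by (rule mult_nonneg_nonneg)
  qed
  finally show ?case .
qed

text \<open>Two elements of opposite sign may be replaced by their sum, at the cost of a
  nonnegative term of lower degree.\<close>

lemma homog_even_nonneg: "fps_nth (homog A) (2 * r) \<ge> 0"
proof (induction r arbitrary: A)
  case 0
  have "fps_nth (homog A) 0 = 1" by (induction A) auto
  then show ?case by simp
next
  case (Suc r)
  show ?case
  \<comment> \<open>The merged multiset keeps the degree but has one element less; the remainder has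
    more elements but degree \<open>2 * r\<close>, where the outer hypothesis holds for all
    multisets.\<close>
  proof (induction A rule: measure_induct_rule[where f = size])
    case (less A)
    show ?case
    proof (cases "\<exists>x y. x \<in># A \<and> y \<in># A \<and> x < 0 \<and> y > 0")
      case True
      then obtain x y where xy: "x \<in># A" "y \<in># A" "x < 0" "y > 0" by blast
      define C where "C = A - {#x, y#}"
      have A: "A = {#x, y#} + C"
        using xy unfolding C_def
        by (intro multiset_eqI) (auto simp: count_greater_zero_iff[symmetric] simp del: count_greater_zero_iff)
      have "homog A = homog (add_mset (x + y) C)
          + fps_const (- (x * y)) * (fps_X ^ 2 * homog ({#x, y, x + y#} + C))"
        unfolding A using geom_mult_geom[of x y]
        by (simp add: algebra_simps flip: distrib_left)
           (metis (no_types, opaque_lifting) distrib_right mult.assoc mult.commute)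
      then have "fps_nth (homog A) (2 * Suc r) = fps_nth (homog (add_mset (x + y) C)) (2 * Suc r)
          + - (x * y) * fps_nth (homog ({#x, y, x + y#} + C)) (2 * r)"
        by (simp add: fps_X_power_mult_nth del: homog_simps)
      moreover have "fps_nth (homog (add_mset (x + y) C)) (2 * Suc r) \<ge> 0"
        by (rule less) (simp add: A)
      moreover have "- (x * y) \<ge> 0" using xy by (simp add: mult_nonpos_nonneg)
      ultimately show ?thesis using Suc.IH[of "{#x, y, x + y#} + C"]
        by (metis add_nonneg_nonneg mult_nonneg_nonneg)
    next
      case False
      then have "(\<forall>y\<in>#A. 1 * y \<ge> 0) \<or> (\<forall>y\<in>#A. (- 1) * y \<ge> 0)"
        by (metis linorder_le_cases mult_1 mult_minus1 neg_0_le_iff_le order.order_iff_strict)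
      then show ?thesis
        using homog_same_sign[of A 1 "2 * Suc r"] homog_same_sign[of A "- 1" "2 * Suc r"]
        by (auto simp: power_mult)
    qed
  qed
qed

section \<open>Linear functionals on polynomials given by a sequence of moments\<close>

definition moment :: "(nat \<Rightarrow> real) \<Rightarrow> real poly \<Rightarrow> real" where
  "moment b p = (\<Sum>i\<le>degree p. coeff p i * b i)"

lemma moment_altdef: "degree p \<le> N \<Longrightarrow> moment b p = (\<Sum>i\<le>N. coeff p i * b i)"
  unfolding moment_def by (intro sum.mono_neutral_left) (auto simp: coeff_eq_0)

lemma moment_add: "moment b (p + q) = moment b p + moment b q"
proof -
  let ?N = "max (degree p) (degree q)"
  show ?thesis
    using degree_add_le_max[of p q]
    by (simp add: moment_altdef[of _ ?N] sum.distrib algebra_simps)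
qed

lemma moment_smult: "moment b (smult c p) = c * moment b p"
  by (simp add: moment_altdef[of _ "degree p"] degree_smult_le sum_distrib_left algebra_simps)

lemma moment_diff: "moment b (p - q) = moment b p - moment b q"
  using moment_add[of b p "smult (- 1) q"] moment_smult[of b "- 1" q] by simp

lemma moment_monom: "moment b (monom c n) = c * b n"
  by (simp add: moment_altdef[of _ n] degree_monom_le if_distrib[of "\<lambda>x. x * _"] cong: if_cong)

lemma moment_sum: "moment b (\<Sum>i\<in>S. f i) = (\<Sum>i\<in>S. moment b (f i))"
  by (induction S rule: infinite_finite_induct) (auto simp: moment_add moment_def[of b 0])

lemma moment_mult:
  "moment b (p * q) = (\<Sum>i\<le>degree p. \<Sum>j\<le>degree q. coeff p i * coeff q j * b (i + j))"
proof -
  have "p * q = (\<Sum>i\<le>degree p. monom (coeff p i) i) * (\<Sum>j\<le>degree q. monom (coeff q j) j)"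
    by (simp add: poly_as_sum_of_monoms)
  also have "\<dots> = (\<Sum>i\<le>degree p. \<Sum>j\<le>degree q. monom (coeff p i * coeff q j) (i + j))"
    by (simp add: sum_product mult_monom)
  finally show ?thesis by (simp add: moment_sum moment_monom)
qed

text \<open>Subtract the minimum \<open>m\<close>, attained at \<open>a\<close>: then
  \<open>a\<close> is a double zero of p - m, and the cofactor inherits nonnegativity.\<close>

lemma nonneg_poly_min:
  fixes p :: "real poly"
  assumes nn: "\<And>x. poly p x \<ge> 0" and deg: "degree p > 0"
  obtains m a q where "m \<ge> 0" "p = [:m:] + [:- a, 1:]\<^sup>2 * q" "\<And>x. poly q x \<ge> 0"
    "degree q < degree p"
proof -
  have "filterlim (poly p) at_infinity at_infinity"
    using deg by (rule filterlim_poly_at_infinity)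
  then obtain R where R: "\<And>x. norm x \<ge> R \<Longrightarrow> norm (poly p x) \<ge> poly p 0 + 1"
    unfolding filterlim_at_infinity[OF order_refl] eventually_at_infinity
    using nn[of 0] by (metis add_pos_nonneg add.commute zero_less_one)
  define K where "K = cball (0 :: real) (max R 0)"
  have "compact K" "K \<noteq> {}" "continuous_on K (poly p)"
    by (auto simp: K_def intro!: continuous_intros)
  then obtain a where a: "a \<in> K" "\<And>x. x \<in> K \<Longrightarrow> poly p a \<le> poly p x"
    using continuous_attains_inf[of K "poly p"] by blast
  have min: "poly p a \<le> poly p x" for x
  proof (cases "x \<in> K")
    \<comment> \<open>Outside the ball \<open>p\<close> exceeds its value at 0, and 0 lies in the
      ball because the radius is \<open>max R 0\<close>.\<close>
    case False
    then have "poly p x \<ge> poly p 0 + 1"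
      using R[of x] nn[of x] by (auto simp: K_def)
    then show ?thesis using a(2)[of 0] by (simp add: K_def)
  qed (use a in blast)
  define m where "m = poly p a"
  have "poly (p - [:m:]) a = 0" by (simp add: m_def)
  then obtain r where r: "p - [:m:] = [:- a, 1:] * r"
    unfolding poly_eq_0_iff_dvd by (rule dvdE)
  have "poly (pderiv p) a = 0"
    by (rule DERIV_local_min[of "poly p" _ a 1]) (auto intro: poly_DERIV min)
  moreover have "pderiv p = pderiv (p - [:m:])" by (simp add: pderiv_diff)
  ultimately have "poly r a = 0"
    unfolding r pderiv_mult by (simp add: pderiv_pCons)
  then obtain q where q: "r = [:- a, 1:] * q"
    unfolding poly_eq_0_iff_dvd by (rule dvdE)
  have "p = [:m:] + [:- a, 1:] * r"
    unfolding r[symmetric] by simp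
  then have p: "p = [:m:] + [:- a, 1:]\<^sup>2 * q"
    unfolding q by (simp only: power2_eq_square mult.assoc)
  have off: "poly q x \<ge> 0" if "x \<noteq> a" for x
  proof -
    have "(x - a)\<^sup>2 * poly q x \<ge> 0"
      using min[of x] arg_cong[OF p, of "\<lambda>p. poly p x"] by (simp add: m_def)
    then show ?thesis using that by (simp add: zero_le_mult_iff)
  qed
  \<comment> \<open>Division by (x - a)^2 fails at \<open>a\<close> itself, so the sign there comes
    from continuity.\<close>
  have "poly q a \<ge> 0"
  proof (rule tendsto_lowerbound)
    show "(poly q \<longlongrightarrow> poly q a) (at a)"
      using poly_isCont[of a q] by (simp add: isCont_def)
    show "eventually (\<lambda>x. 0 \<le> poly q x) (at a)"
      using off by (auto simp: eventually_at_filter)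
  qed simp
  then have "poly q x \<ge> 0" for x using off by (cases "x = a") auto
  moreover have "degree q < degree p"
  proof -
    define s where "s = [:- a, 1:]\<^sup>2 * q"
    have "q \<noteq> 0"
    proof
      assume "q = 0"
      with p have "p = [:m:]" by simp
      with deg show False by simp
    qed
    then have s: "degree s = 2 + degree q"
      by (simp add: s_def degree_mult_eq degree_power_eq)
    have "degree p = degree s"
      unfolding p s_def[symmetric] using s by (intro degree_add_eq_right) simp
    with s show ?thesis by simp
  qed
  ultimately show ?thesis
    using that[OF _ p] nn[of a] unfolding m_def by blast
qed

text \<open>Instead of writing a nonnegative polynomial as a sum of squares, split off squared
  linear factors and absorb them into the functional.\<close>

lemma positive_functional_mono:
  fixes L :: "real poly \<Rightarrow> real"
  assumes "\<And>p q. L (p + q) = L p + L q" "\<And>c p. L (smult c p) = c * L p"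
    and "\<And>p. L (p * p) \<ge> 0" and "\<And>x. poly p x \<ge> 0"
  shows "L p \<ge> 0"
  using assms
proof (induction "degree p" arbitrary: p L rule: less_induct)
  case less
  have L1: "L 1 \<ge> 0" using less.prems(3)[of 1] by simp
  have const: "L [:c:] \<ge> 0" if "c \<ge> 0" for c
    using less.prems(2)[of c 1] that L1 by (simp add: mult_nonneg_nonneg)
  show ?case
  proof (cases "degree p = 0")
    case True
    then obtain c where "p = [:c:]" by (rule degree_eq_zeroE)
    then show ?thesis using const[of c] less.prems(4)[of 0] by simp
  next
    case False
    then obtain m a q where q: "m \<ge> 0" "p = [:m:] + [:- a, 1:]\<^sup>2 * q"
        "\<And>x. poly q x \<ge> 0" "degree q < degree p"
      using nonneg_poly_min[OF less.prems(4)] by blast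
    \<comment> \<open>The functional taking q to L((x - a)^2 q) is again nonnegative on squares,
      since (x - a)^2 p^2 is the square of (x - a) p.\<close>
    have "L ([:- a, 1:]\<^sup>2 * q) \<ge> 0"
    proof (rule less.hyps[OF q(4), of "\<lambda>q. L ([:- a, 1:]\<^sup>2 * q)"])
      show "L ([:- a, 1:]\<^sup>2 * (p * p)) \<ge> 0" for p
        using less.prems(3)[of "[:- a, 1:] * p"]
        by (simp add: power2_eq_square algebra_simps del: mult_pCons_left mult_pCons_right)
      show "L ([:- a, 1:]\<^sup>2 * (p + q)) = L ([:- a, 1:]\<^sup>2 * p) + L ([:- a, 1:]\<^sup>2 * q)" for p q
        by (simp only: distrib_left less.prems(1))
      show "L ([:- a, 1:]\<^sup>2 * smult c p) = c * L ([:- a, 1:]\<^sup>2 * p)" for c p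
        by (simp only: mult_smult_right less.prems(2))
    qed (use q in auto)
    then show ?thesis
      unfolding q(2) less.prems(1) using const[OF q(1)] by simp
  qed
qed

text \<open>Total mass 1 and nonnegative Hankel forms: by Hamburger's theorem exactly the moment
  sequences of probability measures on the line.\<close>

definition moment_sequence :: "(nat \<Rightarrow> real) \<Rightarrow> bool" where
  "moment_sequence b \<longleftrightarrow> b 0 = 1 \<and>
     (\<forall>a n. (\<Sum>i\<le>n. \<Sum>j\<le>n. a i * a j * b (i + j)) \<ge> 0)"

text \<open>\<open>moment b (p * p)\<close> is the Hankel form of \<open>b\<close> at the
  coefficients of \<open>p\<close>, hence nonnegative.\<close>

lemma moment_nonneg:
  assumes "moment_sequence b" "\<And>x. poly p x \<ge> 0"
  shows "moment b p \<ge> 0"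
proof (rule positive_functional_mono)
  show "moment b (p * p) \<ge> 0" for p
    using assms(1) by (simp add: moment_mult moment_sequence_def)
qed (use assms in \<open>auto simp: moment_add moment_smult\<close>)

lemma moment_mono:
  assumes "moment_sequence b" "\<And>x. poly p x \<le> poly q x"
  shows "moment b p \<le> moment b q"
  using moment_nonneg[of b "q - p"] assms by (simp add: moment_diff)

text \<open>A coefficient of \<open>geom x * F\<close> read as a polynomial in \<open>x\<close>.
  Applying \<open>moment b\<close> replaces \<open>geom x\<close> by \<open>Abs_fps b\<close>, so
  inequalities valid for every real \<open>x\<close> become inequalities for
  \<open>b\<close>.\<close>

definition geom_poly :: "nat \<Rightarrow> real fps \<Rightarrow> real poly" where
  "geom_poly n F = (\<Sum>j\<le>n. monom (fps_nth F (n - j)) j)"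

lemma poly_geom_poly: "poly (geom_poly n F) x = fps_nth (geom x * F) n"
  unfolding fps_mult_nth geom_poly_def poly_sum
  by (simp add: poly_monom atLeast0AtMost mult.commute)

lemma moment_geom_poly: "moment b (geom_poly n F) = fps_nth (Abs_fps b * F) n"
  unfolding fps_mult_nth geom_poly_def moment_sum
  by (simp add: moment_monom atLeast0AtMost mult.commute)

text \<open>With \<open>b\<close> the moments of a random variable, this is Jensen's inequality for the convex
  polynomial \<^term>\<open>fps_nth (homog A) (2 * r)\<close> in one of its variables: the coefficient of
  the quadratic remainder in \<open>geom_tangent\<close> is a nonnegative even coefficient.\<close>

lemma moment_jensen:
  assumes b: "moment_sequence b"
  shows "fps_nth (Abs_fps b * homog A) (2 * r) \<ge> fps_nth (geom (b 1) * homog A) (2 * r)"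
proof -
  define c where "c = b 1"
  define v where "v = fps_nth (geom c * homog A) (2 * r)"
  define k where "k = fps_nth (fps_X * geom c ^ 2 * homog A) (2 * r)"
  have "moment b ([:v:] + smult k [:- c, 1:]) \<le> moment b (geom_poly (2 * r) (homog A))"
  proof (rule moment_mono[OF b])
    fix x
    have "geom x * homog A = geom c * homog A
        + fps_const (x - c) * (fps_X * geom c ^ 2 * homog A)
        + fps_const ((x - c)\<^sup>2) * (fps_X ^ 2 * homog ({#x, c, c#} + A))"
      by (subst geom_tangent[of x c]) (simp add: algebra_simps power2_eq_square)
    then have "fps_nth (geom x * homog A) (2 * r) = v + (x - c) * k
        + (x - c)\<^sup>2 * fps_nth (fps_X ^ 2 * homog ({#x, c, c#} + A)) (2 * r)"
      by (simp add: v_def k_def del: homog_simps)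
    \<comment> \<open>The index drops to 2(r - 1), which is even; for r = 0 the factor X^2 makes the
      coefficient vanish.\<close>
    moreover have "fps_nth (fps_X ^ 2 * homog ({#x, c, c#} + A)) (2 * r) \<ge> 0"
      using homog_even_nonneg[of _ "r - 1"]
      by (cases r) (auto simp: fps_X_power_mult_nth simp del: homog_simps)
    ultimately show "poly ([:v:] + smult k [:- c, 1:]) x \<le> poly (geom_poly (2 * r) (homog A)) x"
      by (simp add: poly_geom_poly algebra_simps)
  qed
  \<comment> \<open>The linear term has moment 0 because \<open>b 0 = 1\<close> and
    \<open>b 1 = c\<close>; the case split settles the degree.\<close>
  moreover have "moment b ([:v:] + smult k [:- c, 1:]) = v"
    using b by (cases "k = 0") (simp_all add: moment_def moment_sequence_def c_def)
  ultimately show ?thesis by (simp add: moment_geom_poly v_def c_def)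
qed

text \<open>The factors are replaced one at a time: Jensen in one variable with the others at the
  mean \<open>b 1\<close>, then the induction hypothesis with \<open>x\<close> added to
  \<open>A\<close>, averaged over \<open>x\<close>.\<close>

lemma moment_power_ge:
  assumes b: "moment_sequence b"
  shows "fps_nth (Abs_fps b ^ i * homog A) (2 * r) \<ge> fps_nth (geom (b 1) ^ i * homog A) (2 * r)"
proof (induction i arbitrary: A)
  case (Suc i)
  have "fps_nth (geom (b 1) ^ Suc i * homog A) (2 * r)
      \<le> fps_nth (Abs_fps b * homog (replicate_mset i (b 1) + A)) (2 * r)"
    using moment_jensen[OF b, where A = "replicate_mset i (b 1) + A"] by (simp add: algebra_simps)
  also have "\<dots> \<le> fps_nth (Abs_fps b * (Abs_fps b ^ i * homog A)) (2 * r)"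
    unfolding moment_geom_poly[symmetric]
  proof (rule moment_mono[OF b])
    show "poly (geom_poly (2 * r) (homog (replicate_mset i (b 1) + A))) x
        \<le> poly (geom_poly (2 * r) (Abs_fps b ^ i * homog A)) x" for x
      using Suc[of "add_mset x A"] by (simp add: poly_geom_poly algebra_simps)
  qed
  finally show ?case by (simp add: algebra_simps)
qed simp

subsection \<open>Generating functions of path and cycle densities\<close>

text \<open>Geometric series for P = B/(1 - a X B), obtained by iterating the recursion; after k + 1
  steps the remainder is divisible by X^(k+1).\<close>

lemma fps_path_nth:
  fixes P B :: "real fps"
  assumes "P = B + fps_const a * fps_X * P * B"
  shows "fps_nth P k = (\<Sum>m\<le>k. a ^ m * fps_nth (B ^ Suc m) (k - m))"
proof -
  have P: "P = (\<Sum>m<N. fps_const (a ^ m) * (fps_X ^ m * B ^ Suc m))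
      + fps_X ^ N * (fps_const (a ^ N) * B ^ N * P)" for N
  proof (induction N)
    case (Suc N)
    have ring: "z * (c * x * (B + d * y * P * B))
        = c * (z * (B * x)) + y * z * (d * c * (B * x) * P)" for c d x y z :: "real fps"
      by (simp add: algebra_simps)
    have "fps_X ^ N * (fps_const (a ^ N) * B ^ N * P)
       = fps_X ^ N * (fps_const (a ^ N) * B ^ N * (B + fps_const a * fps_X * P * B))"
      by (rule arg_cong[OF assms])
    also have "\<dots> = fps_const (a ^ N) * (fps_X ^ N * B ^ Suc N)
         + fps_X ^ Suc N * (fps_const (a ^ Suc N) * B ^ Suc N * P)"
      unfolding power_Suc fps_const_mult[symmetric] by (rule ring)
    finally have "fps_X ^ N * (fps_const (a ^ N) * B ^ N * P)
       = fps_const (a ^ N) * (fps_X ^ N * B ^ Suc N)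
         + fps_X ^ Suc N * (fps_const (a ^ Suc N) * B ^ Suc N * P)" .
    with Suc show ?case by (simp add: add.assoc)
  qed simp
  show ?thesis
    by (subst P[of "Suc k"])
       (simp add: fps_sum_nth fps_X_power_mult_nth lessThan_Suc_atMost del: power_Suc)
qed

text \<open>With Y = a X B the series D is X Y'/(1 - Y), which is X d/dX applied to - log(1 - Y),
  the sum of Y^(m+1)/(m+1). The operator X d/dX multiplies the coefficient of index \<open>n\<close>
  by \<open>n\<close>.\<close>

lemma fps_cycle_nth:
  fixes P B D :: "real fps"
  assumes "P = B + fps_const a * fps_X * P * B"
    and "D = fps_const a * fps_X * fps_deriv (fps_X * B) * (1 + fps_const a * fps_X * P)"
  shows "fps_nth D n = (\<Sum>m<n. a ^ Suc m * (n / Suc m) * fps_nth (B ^ Suc m) (n - Suc m))"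
proof -
  define Y where "Y = fps_const a * fps_X * B"
  define Q where "Q = 1 + fps_const a * fps_X * P"
  have Q: "Q = 1 + Y * Q"
    using assms(1) unfolding Q_def Y_def by algebra
  have QN: "Q = (\<Sum>m<N. Y ^ m) + Y ^ N * Q" for N
  proof (induction N)
    case (Suc N)
    have "Y ^ N * Q = Y ^ N + Y ^ Suc N * Q"
      by (subst Q) (simp add: algebra_simps)
    with Suc show ?case by (simp add: add.assoc)
  qed simp
  have dY: "fps_deriv Y = fps_const a * fps_deriv (fps_X * B)"
    by (simp add: Y_def mult.assoc)
  have "D = fps_X * fps_deriv Y * Q"
    unfolding dY assms(2) Q_def by (simp add: algebra_simps)
  \<comment> \<open>Truncation after \<open>n\<close> terms suffices: Y^n and the extra factor X
    together put the remainder beyond index \<open>n\<close>.\<close>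
  also have "\<dots> = (\<Sum>m<n. fps_X * (Y ^ m * fps_deriv Y)) + fps_X ^ Suc n *
      (fps_const (a ^ n) * B ^ n * fps_deriv Y * Q)"
    by (subst QN[of n]) (simp add: Y_def power_mult_distrib algebra_simps sum_distrib_left
        flip: fps_const_power)
  finally have "fps_nth D n = (\<Sum>m<n. fps_nth (fps_X * (Y ^ m * fps_deriv Y)) n)"
    by (simp add: fps_sum_nth fps_X_power_mult_nth del: power_Suc)
  also have "\<dots> = (\<Sum>m<n. a ^ Suc m * (n / Suc m) * fps_nth (B ^ Suc m) (n - Suc m))"
  proof (intro sum.cong refl)
    fix m assume "m \<in> {..<n}"
    then have m: "m < n" by simp
    have "fps_X * fps_deriv (Y ^ Suc m)
        = fps_const (real (Suc m)) * (fps_X * (Y ^ m * fps_deriv Y))"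
      unfolding fps_deriv_power diff_Suc_1 by (simp only: ac_simps)
    then have "real (Suc m) * fps_nth (fps_X * (Y ^ m * fps_deriv Y)) n
        = fps_nth (fps_X * fps_deriv (Y ^ Suc m)) n"
      by (simp only: fps_mult_left_const_nth)
    also have "\<dots> = real n * fps_nth (Y ^ Suc m) n"
      using m by (cases n) (simp_all del: power_Suc)
    also have "Y ^ Suc m = fps_X ^ Suc m * (fps_const (a ^ Suc m) * B ^ Suc m)"
      unfolding Y_def power_mult_distrib fps_const_power by (simp only: ac_simps)
    also have "fps_nth \<dots> n = a ^ Suc m * fps_nth (B ^ Suc m) (n - Suc m)"
      using m unfolding fps_X_power_mult_nth by (simp del: power_Suc)
    finally show "fps_nth (fps_X * (Y ^ m * fps_deriv Y)) n
        = a ^ Suc m * (n / Suc m) * fps_nth (B ^ Suc m) (n - Suc m)"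
      by (simp add: field_simps del: power_Suc)
  qed
  finally show ?thesis .
qed

section \<open>The substitution of - X for X, and comparison with constant kernels\<close>

definition alternate :: "real fps \<Rightarrow> real fps" where
  "alternate F = Abs_fps (\<lambda>n. (- 1) ^ n * fps_nth F n)"

lemma alternate_nth [simp]: "fps_nth (alternate F) n = (- 1) ^ n * fps_nth F n"
  by (simp add: alternate_def)

lemma alternate_mult: "alternate (F * G) = alternate F * alternate G"
proof (rule fps_ext)
  fix n
  have "(- 1) ^ n * (f * g) = ((- 1) ^ i * f) * ((- 1) ^ (n - i) * g)" if "i \<in> {0..n}"
    for i and f g :: real
  proof -
    have "(- 1 :: real) ^ n = (- 1) ^ i * (- 1) ^ (n - i)"
      using that by (simp flip: power_add)
    then show ?thesis by simp
  qed
  then show "fps_nth (alternate (F * G)) n = fps_nth (alternate F * alternate G) n"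
    unfolding fps_mult_nth alternate_nth sum_distrib_left by (intro sum.cong refl)
qed

lemma alternate_power: "alternate (F ^ m) = alternate F ^ m"
proof (induction m)
  case 0
  show ?case by (rule fps_ext) simp
qed (simp add: alternate_mult)

lemma alternate_geom: "alternate (geom c) = geom (- c)"
  by (rule fps_ext) (simp add: power_mult_distrib[symmetric])

text \<open>The recursion for paths in the model case of the constant kernel \<open>c\<close>, whose
  path densities are the powers of \<open>c\<close>.\<close>

lemma geom_path: "geom (a + c) = geom c + fps_const a * fps_X * geom (a + c) * geom c"
proof -
  have "fps_const (a + c) = fps_const a + fps_const c" by simp
  then show ?thesis using geom_eq[of c] geom_eq[of "a + c"] by algebra
qed

lemma fps_deriv_X_geom: "fps_deriv (fps_X * geom c) = geom c ^ 2"
proof (rule fps_ext)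
  fix n
  have "fps_nth (geom c ^ 2) n = (\<Sum>i=0..n. c ^ n)"
    unfolding power2_eq_square fps_mult_nth by (intro sum.cong) (auto simp flip: power_add)
  then show "fps_nth (fps_deriv (fps_X * geom c)) n = fps_nth (geom c ^ 2) n"
    by (simp add: distrib_right)
qed

text \<open>The model case for cycles: the trace of a power of the constant kernel a + c minus that
  of the constant kernel \<open>c\<close>.\<close>

lemma geom_cycle:
  "fps_const a * fps_X * fps_deriv (fps_X * geom c) * (1 + fps_const a * fps_X * geom (a + c))
    = geom (a + c) - geom c"
  unfolding fps_deriv_X_geom using geom_path[of a c] by algebra

lemma alternate_pair_sum:
  "F + (- 1) ^ n * F = (if even n then 2 * F else 0)" for F :: real
  by simp

lemma moment_even_coeff_ge:
  assumes "moment_sequence b" "even j"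
  shows "fps_nth (geom (b 1) ^ i) j \<le> fps_nth (Abs_fps b ^ i) j"
  using moment_power_ge[OF assms(1), of i "{#}" "j div 2"] assms(2) by simp

text \<open>Both sides are values of one functional \<open>S\<close>, at \<open>geom (b 1)\<close>
  and at \<open>Abs_fps b\<close>. Its terms with k - m odd vanish, and the others compare by
  \<open>moment_even_coeff_ge\<close> with nonnegative weights.\<close>

lemma path_coeffs_ge:
  assumes b: "moment_sequence b"
    and P: "P = Abs_fps b + fps_const a * fps_X * P * Abs_fps b"
    and Q: "Q = alternate (Abs_fps b) + fps_const a * fps_X * Q * alternate (Abs_fps b)"
    and a: "a \<ge> 0"
  shows "fps_nth P k + fps_nth Q k \<ge> (a + b 1) ^ k + (a - b 1) ^ k"
proof -
  define S where "S B = (\<Sum>m\<le>k. a ^ m *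
    (fps_nth (B ^ Suc m) (k - m) + fps_nth (alternate B ^ Suc m) (k - m)))" for B
  have S: "fps_nth P k + fps_nth Q k = S B"
    if "P = B + fps_const a * fps_X * P * B"
      "Q = alternate B + fps_const a * fps_X * Q * alternate B" for B P Q
    unfolding fps_path_nth[OF that(1)] fps_path_nth[OF that(2)] S_def
    by (simp add: sum.distrib distrib_left del: power_Suc)
  have "(a + b 1) ^ k + (a - b 1) ^ k = S (geom (b 1))"
    using S[OF geom_path[of a "b 1"], of "geom (a - b 1)"] geom_path[of a "- b 1"]
    by (simp add: alternate_geom)
  also have "\<dots> \<le> S (Abs_fps b)"
    unfolding S_def alternate_power[symmetric] alternate_nth alternate_pair_sum
    using moment_even_coeff_ge[OF b] a
    by (intro sum_mono mult_left_mono) (auto simp del: power_Suc)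
  also have "\<dots> = fps_nth P k + fps_nth Q k"
    using S[OF P Q] by simp
  finally show ?thesis .
qed

lemma odd_cycle_coeffs_ge:
  assumes b: "moment_sequence b"
    and P: "P = Abs_fps b + fps_const a * fps_X * P * Abs_fps b"
    and Q: "Q = alternate (Abs_fps b) + fps_const a * fps_X * Q * alternate (Abs_fps b)"
    and D: "D = fps_const a * fps_X * fps_deriv (fps_X * Abs_fps b)
      * (1 + fps_const a * fps_X * P)"
    and E: "E = fps_const a * fps_X * fps_deriv (fps_X * alternate (Abs_fps b))
      * (1 + fps_const a * fps_X * Q)"
    and a: "a \<ge> 0" and k: "odd k"
  shows "fps_nth D k + fps_nth E k \<ge> (a + b 1) ^ k + (a - b 1) ^ k"
proof -
  define S where "S B = (\<Sum>m<k. a ^ Suc m * (k / Suc m) *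
    (fps_nth (B ^ Suc m) (k - Suc m) + fps_nth (alternate B ^ Suc m) (k - Suc m)))" for B
  have S: "fps_nth D k + fps_nth E k = S B"
    if "P = B + fps_const a * fps_X * P * B"
      "Q = alternate B + fps_const a * fps_X * Q * alternate B"
      "D = fps_const a * fps_X * fps_deriv (fps_X * B) * (1 + fps_const a * fps_X * P)"
      "E = fps_const a * fps_X * fps_deriv (fps_X * alternate B) * (1 + fps_const a * fps_X * Q)"
    for B P Q D E
    unfolding fps_cycle_nth[OF that(1) that(3)] fps_cycle_nth[OF that(2) that(4)] S_def
    by (simp add: sum.distrib distrib_left del: power_Suc)
  \<comment> \<open>The model series also contribute the negated k-th powers of \<open>b 1\<close>
    and \<open>- b 1\<close>, which cancel as \<open>k\<close> is odd.\<close>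
  have "(a + b 1) ^ k + (a - b 1) ^ k = S (geom (b 1))"
    using S[OF geom_path[of a "b 1"] _ geom_cycle[symmetric], of "geom (a - b 1)"
        "geom (a - b 1) - geom (- b 1)"]
      geom_path[of a "- b 1"] geom_cycle[of a "- b 1"] k
    by (simp add: alternate_geom)
  also have "\<dots> \<le> S (Abs_fps b)"
    unfolding S_def alternate_power[symmetric] alternate_nth alternate_pair_sum
    using moment_even_coeff_ge[OF b] a
    by (intro sum_mono mult_left_mono) (auto simp del: power_Suc)
  also have "\<dots> = fps_nth D k + fps_nth E k"
    using S[OF P Q D E] by simp
  finally show ?thesis .
qed

subsection \<open>Powers of a symmetric kernel\<close>

context prob_space
begin

text \<open>This class is closed under products and under \<open>kernel_op\<close> with a bounded
  measurable kernel, and its members are integrable on a probability space.\<close>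

definition bdd_meas :: "('a \<Rightarrow> real) \<Rightarrow> bool" where
  "bdd_meas f \<longleftrightarrow> f \<in> borel_measurable M \<and> (\<exists>C. \<forall>x\<in>space M. \<bar>f x\<bar> \<le> C)"

definition bdd_meas2 :: "('a \<Rightarrow> 'a \<Rightarrow> real) \<Rightarrow> bool" where
  "bdd_meas2 K \<longleftrightarrow> case_prod K \<in> borel_measurable (M \<Otimes>\<^sub>M M) \<and>
     (\<exists>C. \<forall>x\<in>space M. \<forall>y\<in>space M. \<bar>K x y\<bar> \<le> C)"

definition sym_kernel :: "('a \<Rightarrow> 'a \<Rightarrow> real) \<Rightarrow> bool" where
  "sym_kernel K \<longleftrightarrow> bdd_meas2 K \<and> (\<forall>x\<in>space M. \<forall>y\<in>space M. K x y = K y x)"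

definition kernel_op :: "('a \<Rightarrow> 'a \<Rightarrow> real) \<Rightarrow> ('a \<Rightarrow> real) \<Rightarrow> 'a \<Rightarrow> real" where
  "kernel_op W f x = (\<integral>y. W x y * f y \<partial>M)"

lemma bdd_measD [measurable_dest]: "bdd_meas f \<Longrightarrow> f \<in> borel_measurable M"
  by (simp add: bdd_meas_def)

lemma bdd_meas_bound:
  assumes "bdd_meas f"
  obtains C where "C \<ge> 0" "\<And>x. x \<in> space M \<Longrightarrow> \<bar>f x\<bar> \<le> C"
proof -
  from assms obtain C where "\<forall>x\<in>space M. \<bar>f x\<bar> \<le> C" by (auto simp: bdd_meas_def)
  then show ?thesis by (intro that[of "max C 0"]) (auto simp: le_max_iff_disj)
qed

lemma bdd_meas_integrable:
  assumes "bdd_meas f" shows "integrable M f"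
proof -
  obtain C where "\<And>x. x \<in> space M \<Longrightarrow> \<bar>f x\<bar> \<le> C"
    using assms by (metis bdd_meas_bound)
  then show ?thesis
    using assms by (intro integrable_const_bound[of _ C]) (auto simp: bdd_meas_def)
qed

lemma bdd_meas_const: "bdd_meas (\<lambda>_. c)"
  by (auto simp: bdd_meas_def)

lemma bdd_meas_add:
  assumes "bdd_meas f" "bdd_meas g" shows "bdd_meas (\<lambda>x. f x + g x)"
proof -
  obtain C D where "\<And>x. x \<in> space M \<Longrightarrow> \<bar>f x\<bar> \<le> C" "\<And>x. x \<in> space M \<Longrightarrow> \<bar>g x\<bar> \<le> D"
    using assms by (metis bdd_meas_bound)
  then have "\<forall>x\<in>space M. \<bar>f x + g x\<bar> \<le> C + D"
    by (meson abs_triangle_ineq add_mono order_trans)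
  with assms show ?thesis by (auto simp: bdd_meas_def)
qed

lemma bdd_meas_mult:
  assumes "bdd_meas f" "bdd_meas g" shows "bdd_meas (\<lambda>x. f x * g x)"
proof -
  obtain C where C: "C \<ge> 0" "\<And>x. x \<in> space M \<Longrightarrow> \<bar>f x\<bar> \<le> C"
    using assms(1) by (metis bdd_meas_bound)
  obtain D where D: "D \<ge> 0" "\<And>x. x \<in> space M \<Longrightarrow> \<bar>g x\<bar> \<le> D"
    using assms(2) by (metis bdd_meas_bound)
  have "\<forall>x\<in>space M. \<bar>f x * g x\<bar> \<le> C * D"
    using C D by (auto simp: abs_mult intro!: mult_mono)
  with assms show ?thesis by (auto simp: bdd_meas_def)
qed

lemma bdd_meas_sum: "(\<And>i. i \<in> I \<Longrightarrow> bdd_meas (f i)) \<Longrightarrow> bdd_meas (\<lambda>x. \<Sum>i\<in>I. f i x)"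
  by (induction I rule: infinite_finite_induct) (auto intro: bdd_meas_const bdd_meas_add)

lemma bdd_meas2_bound:
  assumes "bdd_meas2 K"
  obtains C where "C \<ge> 0" "\<And>x y. x \<in> space M \<Longrightarrow> y \<in> space M \<Longrightarrow> \<bar>K x y\<bar> \<le> C"
proof -
  from assms obtain C where "\<forall>x\<in>space M. \<forall>y\<in>space M. \<bar>K x y\<bar> \<le> C"
    by (auto simp: bdd_meas2_def)
  then show ?thesis by (intro that[of "max C 0"]) (auto simp: le_max_iff_disj)
qed

lemma bdd_meas2_compose:
  assumes "bdd_meas2 K" "f \<in> N \<rightarrow>\<^sub>M M" "g \<in> N \<rightarrow>\<^sub>M M"
  shows "(\<lambda>w. K (f w) (g w)) \<in> borel_measurable N"
proof -
  have "case_prod K \<in> borel_measurable (M \<Otimes>\<^sub>M M)"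
    using assms(1) unfolding bdd_meas2_def by blast
  from measurable_compose[OF measurable_Pair[OF assms(2,3)] this]
  show ?thesis by (simp only: case_prod_conv)
qed

lemma bdd_meas2_section: "bdd_meas2 K \<Longrightarrow> x \<in> space M \<Longrightarrow> bdd_meas (K x)"
  using bdd_meas2_compose[of K "\<lambda>_. x" M "\<lambda>y. y", OF _ measurable_const measurable_ident_sets[OF refl]]
  unfolding bdd_meas_def bdd_meas2_def by blast

lemma bdd_meas2_diag: "bdd_meas2 K \<Longrightarrow> bdd_meas (\<lambda>x. K x x)"
  using bdd_meas2_compose[of K "\<lambda>x. x" M "\<lambda>x. x",
      OF _ measurable_ident_sets[OF refl] measurable_ident_sets[OF refl]]
  unfolding bdd_meas_def bdd_meas2_def by blast

lemma bdd_meas2_fst: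
  assumes "bdd_meas f" shows "bdd_meas2 (\<lambda>x y. f x)"
proof -
  have [measurable]: "f \<in> borel_measurable M" using assms by (rule bdd_measD)
  have "(\<lambda>p. f (fst p)) \<in> borel_measurable (M \<Otimes>\<^sub>M M)" by measurable
  moreover obtain C where "\<And>x. x \<in> space M \<Longrightarrow> \<bar>f x\<bar> \<le> C"
    using assms by (metis bdd_meas_bound)
  ultimately show ?thesis unfolding bdd_meas2_def split_beta' by blast
qed

lemma bdd_meas2_snd:
  assumes "bdd_meas f" shows "bdd_meas2 (\<lambda>x y. f y)"
proof -
  have [measurable]: "f \<in> borel_measurable M" using assms by (rule bdd_measD)
  have "(\<lambda>p. f (snd p)) \<in> borel_measurable (M \<Otimes>\<^sub>M M)" by measurable
  moreover obtain C where "\<And>x. x \<in> space M \<Longrightarrow> \<bar>f x\<bar> \<le> C"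
    using assms by (metis bdd_meas_bound)
  ultimately show ?thesis unfolding bdd_meas2_def split_beta' by blast
qed

lemma bdd_meas2_mult:
  assumes "bdd_meas2 K" "bdd_meas2 L" shows "bdd_meas2 (\<lambda>x y. K x y * L x y)"
proof -
  obtain C where C: "C \<ge> 0" "\<And>x y. x \<in> space M \<Longrightarrow> y \<in> space M \<Longrightarrow> \<bar>K x y\<bar> \<le> C"
    using assms(1) by (metis bdd_meas2_bound)
  obtain D where D: "D \<ge> 0" "\<And>x y. x \<in> space M \<Longrightarrow> y \<in> space M \<Longrightarrow> \<bar>L x y\<bar> \<le> D"
    using assms(2) by (metis bdd_meas2_bound)
  have "\<forall>x\<in>space M. \<forall>y\<in>space M. \<bar>K x y * L x y\<bar> \<le> C * D"
    using C D by (auto simp: abs_mult intro!: mult_mono)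
  moreover have "(\<lambda>p. K (fst p) (snd p) * L (fst p) (snd p)) \<in> borel_measurable (M \<Otimes>\<^sub>M M)"
    by (intro borel_measurable_times bdd_meas2_compose[OF assms(1)] bdd_meas2_compose[OF assms(2)]
        measurable_fst measurable_snd)
  ultimately show ?thesis unfolding bdd_meas2_def split_beta' by blast
qed

lemma integral_lincomb:
  assumes "bdd_meas f" "\<And>i. i \<in> I \<Longrightarrow> bdd_meas (g i)"
  shows "(\<integral>x. f x + a * (\<Sum>i\<in>I. c i * g i x) \<partial>M)
    = (\<integral>x. f x \<partial>M) + a * (\<Sum>i\<in>I. c i * (\<integral>x. g i x \<partial>M))"
proof -
  have sum: "(\<integral>x. (\<Sum>i\<in>I. c i * g i x) \<partial>M) = (\<Sum>i\<in>I. c i * (\<integral>x. g i x \<partial>M))"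
    by (subst Bochner_Integration.integral_sum)
       (auto intro!: bdd_meas_integrable bdd_meas_mult bdd_meas_const assms)
  have "(\<integral>x. f x + a * (\<Sum>i\<in>I. c i * g i x) \<partial>M)
    = (\<integral>x. f x \<partial>M) + (\<integral>x. a * (\<Sum>i\<in>I. c i * g i x) \<partial>M)"
    by (intro Bochner_Integration.integral_add bdd_meas_integrable bdd_meas_mult bdd_meas_sum
        bdd_meas_const assms)
  then show ?thesis by (simp add: sum)
qed

lemma integral_abs_le:
  assumes "bdd_meas f" "\<And>x. x \<in> space M \<Longrightarrow> \<bar>f x\<bar> \<le> C"
  shows "\<bar>\<integral>x. f x \<partial>M\<bar> \<le> C"
proof -
  have "\<bar>\<integral>x. f x \<partial>M\<bar> \<le> (\<integral>x. \<bar>f x\<bar> \<partial>M)" by (rule integral_abs_bound)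
  also have "\<dots> \<le> C"
    using bdd_meas_integrable[OF assms(1)] assms(2)
    by (intro integral_le_const) auto
  finally show ?thesis .
qed

text \<open>The operator acts on the second argument with \<open>x\<close> as a parameter; joint
  measurability is kept so that diagonals can be integrated later.\<close>

lemma bdd_meas2_kernel_op:
  assumes W: "bdd_meas2 W" and K: "bdd_meas2 K"
  shows "bdd_meas2 (\<lambda>x. kernel_op W (K x))"
proof -
  have meas: "(\<lambda>p. \<integral>z. W (snd p) z * K (fst p) z \<partial>M) \<in> borel_measurable (M \<Otimes>\<^sub>M M)"
    by (intro borel_measurable_lebesgue_integral, unfold split_beta')
       (intro borel_measurable_times bdd_meas2_compose[OF W] bdd_meas2_compose[OF K]
         measurable_fst'' measurable_snd'' measurable_fst measurable_snd)
  obtain C where C: "C \<ge> 0" "\<And>x y. x \<in> space M \<Longrightarrow> y \<in> space M \<Longrightarrow> \<bar>W x y\<bar> \<le> C"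
    using W by (metis bdd_meas2_bound)
  obtain D where D: "D \<ge> 0" "\<And>x y. x \<in> space M \<Longrightarrow> y \<in> space M \<Longrightarrow> \<bar>K x y\<bar> \<le> D"
    using K by (metis bdd_meas2_bound)
  have "\<forall>x\<in>space M. \<forall>y\<in>space M. \<bar>\<integral>z. W y z * K x z \<partial>M\<bar> \<le> C * D"
  proof (intro ballI integral_abs_le)
    fix x y assume xy: "x \<in> space M" "y \<in> space M"
    show "bdd_meas (\<lambda>z. W y z * K x z)"
      by (intro bdd_meas_mult bdd_meas2_section W K xy)
    show "\<bar>W y z * K x z\<bar> \<le> C * D" if "z \<in> space M" for z
      using C D xy that by (auto simp: abs_mult intro!: mult_mono)
  qed
  with meas show ?thesis
    unfolding bdd_meas2_def kernel_op_def split_beta' by blast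
qed

lemma bdd_meas_kernel_op:
  assumes "bdd_meas2 W" "bdd_meas f" shows "bdd_meas (kernel_op W f)"
proof -
  obtain x where "x \<in> space M" using not_empty by blast
  then show ?thesis
    using bdd_meas2_section[OF bdd_meas2_kernel_op[OF assms(1) bdd_meas2_snd[OF assms(2)]]] by simp
qed

lemma bdd_meas_kernel_op_pow:
  "bdd_meas2 W \<Longrightarrow> bdd_meas f \<Longrightarrow> bdd_meas ((kernel_op W ^^ n) f)"
  by (induction n) (auto intro: bdd_meas_kernel_op)

lemma bdd_meas2_kernel_op_pow:
  "bdd_meas2 W \<Longrightarrow> bdd_meas2 K \<Longrightarrow> bdd_meas2 (\<lambda>x. (kernel_op W ^^ n) (K x))"
  by (induction n) (auto intro: bdd_meas2_kernel_op)

section \<open>Linearity and self-adjointness of the integral operator\<close>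

lemma kernel_op_cong: "(\<And>y. y \<in> space M \<Longrightarrow> f y = g y) \<Longrightarrow> kernel_op W f x = kernel_op W g x"
  unfolding kernel_op_def by (rule Bochner_Integration.integral_cong) auto

lemma kernel_op_add:
  assumes "bdd_meas2 W" "bdd_meas f" "bdd_meas g" "x \<in> space M"
  shows "kernel_op W (\<lambda>y. f y + g y) x = kernel_op W f x + kernel_op W g x"
  unfolding kernel_op_def distrib_left
  by (intro Bochner_Integration.integral_add bdd_meas_integrable bdd_meas_mult
      bdd_meas2_section assms)

lemma kernel_op_cmult: "kernel_op W (\<lambda>y. c * f y) x = c * kernel_op W f x"
proof -
  have "kernel_op W (\<lambda>y. c * f y) x = (\<integral>y. c * (W x y * f y) \<partial>M)"
    unfolding kernel_op_def by (rule arg_cong[where f = "integral\<^sup>L M"]) (auto simp: ac_simps)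
  then show ?thesis by (simp add: kernel_op_def)
qed

lemma kernel_op_sum:
  assumes "bdd_meas2 W" "\<And>i. i \<in> I \<Longrightarrow> bdd_meas (f i)" "x \<in> space M"
  shows "kernel_op W (\<lambda>y. \<Sum>i\<in>I. f i y) x = (\<Sum>i\<in>I. kernel_op W (f i) x)"
  unfolding kernel_op_def sum_distrib_left
  by (intro Bochner_Integration.integral_sum bdd_meas_integrable bdd_meas_mult
      bdd_meas2_section assms)

text \<open>The constant part has rank one: it sees only the integral of \<open>f\<close>. All later
  shift formulas iterate this.\<close>

lemma kernel_op_shift:
  assumes "bdd_meas2 U" "bdd_meas f" "x \<in> space M"
  shows "kernel_op (\<lambda>x y. a + U x y) f x = a * (\<integral>y. f y \<partial>M) + kernel_op U f x"
proof -
  have "kernel_op (\<lambda>x y. a + U x y) f x = (\<integral>y. a * f y + U x y * f y \<partial>M)"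
    by (simp add: kernel_op_def distrib_right)
  also have "\<dots> = (\<integral>y. a * f y \<partial>M) + kernel_op U f x"
    unfolding kernel_op_def
    by (intro Bochner_Integration.integral_add bdd_meas_integrable bdd_meas_mult
      bdd_meas2_section assms bdd_meas_const)
  finally show ?thesis by simp
qed

text \<open>Fubini for the bounded function \<open>K\<close>, then symmetry of
  \<open>W\<close>.\<close>

lemma kernel_op_selfadjoint:
  assumes W: "sym_kernel W" and f: "bdd_meas f" and g: "bdd_meas g"
  shows "(\<integral>x. kernel_op W f x * g x \<partial>M) = (\<integral>x. f x * kernel_op W g x \<partial>M)"
proof -
  interpret P: pair_prob_space M M ..
  have W2: "bdd_meas2 W" using W by (simp add: sym_kernel_def)
  define K where "K x y = W x y * f y * g x" for x y
  have K: "bdd_meas2 K"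
    unfolding K_def by (intro bdd_meas2_mult W2 bdd_meas2_fst bdd_meas2_snd f g)
  then obtain C where "\<And>x y. x \<in> space M \<Longrightarrow> y \<in> space M \<Longrightarrow> \<bar>K x y\<bar> \<le> C"
    by (metis bdd_meas2_bound)
  with K have "integrable (M \<Otimes>\<^sub>M M) (case_prod K)"
    by (intro P.integrable_const_bound[of _ C]) (auto simp: bdd_meas2_def space_pair_measure)
  then have "(\<integral>x. (\<integral>y. K x y \<partial>M) \<partial>M) = (\<integral>y. (\<integral>x. K x y \<partial>M) \<partial>M)"
    by (rule P.Fubini_integral[symmetric])
  moreover have "(\<integral>y. K x y \<partial>M) = kernel_op W f x * g x" for x
    by (simp add: K_def kernel_op_def)
  moreover have "(\<integral>x. K x y \<partial>M) = f y * kernel_op W g y" if y: "y \<in> space M" for y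
  proof -
    have "(\<integral>x. K x y \<partial>M) = (\<integral>x. f y * (W y x * g x) \<partial>M)"
      using W y by (intro Bochner_Integration.integral_cong) (auto simp: K_def sym_kernel_def)
    then show ?thesis by (simp add: kernel_op_def)
  qed
  ultimately show ?thesis by (simp cong: Bochner_Integration.integral_cong)
qed

lemma kernel_op_pow_selfadjoint:
  assumes W: "sym_kernel W" and f: "bdd_meas f" and g: "bdd_meas g"
  shows "(\<integral>x. (kernel_op W ^^ n) f x * g x \<partial>M) = (\<integral>x. f x * (kernel_op W ^^ n) g x \<partial>M)"
  using f
proof (induction n arbitrary: f)
  case (Suc n)
  have W2: "bdd_meas2 W" using W by (simp add: sym_kernel_def)
  have "(\<integral>x. (kernel_op W ^^ Suc n) f x * g x \<partial>M)
      = (\<integral>x. (kernel_op W ^^ n) (kernel_op W f) x * g x \<partial>M)"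
    by (simp add: funpow_swap1)
  also have "\<dots> = (\<integral>x. kernel_op W f x * (kernel_op W ^^ n) g x \<partial>M)"
    by (intro Suc bdd_meas_kernel_op W2)
  also have "\<dots> = (\<integral>x. f x * (kernel_op W ^^ Suc n) g x \<partial>M)"
    by (simp add: kernel_op_selfadjoint[OF W] Suc bdd_meas_kernel_op_pow W2 g)
  finally show ?case .
qed simp

section \<open>Walk densities, kernel powers and traces, and the effect of adding a constant\<close>

definition walk :: "('a \<Rightarrow> 'a \<Rightarrow> real) \<Rightarrow> nat \<Rightarrow> 'a \<Rightarrow> real" where
  "walk W n = (kernel_op W ^^ n) (\<lambda>_. 1)"

definition path_density :: "('a \<Rightarrow> 'a \<Rightarrow> real) \<Rightarrow> nat \<Rightarrow> real" where
  "path_density W n = (\<integral>x. walk W n x \<partial>M)"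

text \<open>The \<open>(n + 1)\<close>-st power of the kernel.\<close>

definition kernel_pow :: "('a \<Rightarrow> 'a \<Rightarrow> real) \<Rightarrow> nat \<Rightarrow> 'a \<Rightarrow> 'a \<Rightarrow> real" where
  "kernel_pow W n x = (kernel_op W ^^ n) (W x)"

text \<open>The density of closed walks with n + 1 edges, since \<open>kernel_pow W n\<close> is the
  power of exponent n + 1.\<close>

definition kernel_trace :: "('a \<Rightarrow> 'a \<Rightarrow> real) \<Rightarrow> nat \<Rightarrow> real" where
  "kernel_trace W n = (\<integral>x. kernel_pow W n x x \<partial>M)"

lemma walk_simps [simp]: "walk W 0 x = 1" "walk W (Suc n) = kernel_op W (walk W n)"
  by (simp_all add: walk_def)

lemma kernel_pow_simps [simp]:
  "kernel_pow W 0 x = W x" "kernel_pow W (Suc n) x = kernel_op W (kernel_pow W n x)"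
  by (simp_all add: kernel_pow_def)

lemma bdd_meas_walk: "bdd_meas2 W \<Longrightarrow> bdd_meas (walk W n)"
  unfolding walk_def by (intro bdd_meas_kernel_op_pow bdd_meas_const)

lemma bdd_meas2_kernel_pow: "bdd_meas2 W \<Longrightarrow> bdd_meas2 (kernel_pow W n)"
  unfolding kernel_pow_def by (intro bdd_meas2_kernel_op_pow)

lemma bdd_meas2_add_const:
  assumes "bdd_meas2 U" shows "bdd_meas2 (\<lambda>x y. a + U x y)"
proof -
  obtain C where "\<And>x y. x \<in> space M \<Longrightarrow> y \<in> space M \<Longrightarrow> \<bar>U x y\<bar> \<le> C"
    using assms by (metis bdd_meas2_bound)
  then have "\<forall>x\<in>space M. \<forall>y\<in>space M. \<bar>a + U x y\<bar> \<le> \<bar>a\<bar> + C"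
    by (meson abs_triangle_ineq add_left_mono order_trans)
  moreover have "(\<lambda>p. a + U (fst p) (snd p)) \<in> borel_measurable (M \<Otimes>\<^sub>M M)"
    by (intro borel_measurable_add borel_measurable_const bdd_meas2_compose[OF assms]
        measurable_fst measurable_snd)
  ultimately show ?thesis unfolding bdd_meas2_def split_beta' by blast
qed

lemma path_density_0: "path_density W 0 = 1"
  by (simp add: path_density_def prob_space)

text \<open>Self-adjointness moves all \<open>i\<close> applications of the operator to the other
  factor.\<close>

lemma integral_walk_walk:
  assumes "sym_kernel W"
  shows "(\<integral>x. walk W i x * walk W j x \<partial>M) = path_density W (i + j)"
proof -
  have W2: "bdd_meas2 W" using assms by (simp add: sym_kernel_def)
  have "(\<integral>x. walk W i x * walk W j x \<partial>M) = (\<integral>x. 1 * (kernel_op W ^^ i) (walk W j) x \<partial>M)"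
    by (subst walk_def)
       (intro kernel_op_pow_selfadjoint assms bdd_meas_const bdd_meas_walk W2)
  then show ?thesis by (simp add: path_density_def walk_def funpow_add)
qed

text \<open>Self-adjointness moves the operator from the section \<open>W x\<close> to the constant
  function 1.\<close>

lemma integral_kernel_pow:
  assumes "sym_kernel W" "x \<in> space M"
  shows "(\<integral>y. kernel_pow W n x y \<partial>M) = walk W (Suc n) x"
proof -
  have W2: "bdd_meas2 W" using assms by (simp add: sym_kernel_def)
  have "(\<integral>y. kernel_pow W n x y * 1 \<partial>M) = (\<integral>y. W x y * walk W n y \<partial>M)"
    unfolding kernel_pow_def walk_def
    by (intro kernel_op_pow_selfadjoint assms bdd_meas_const bdd_meas2_section W2)
  then show ?thesis by (simp add: kernel_op_def)
qed

text \<open>The Hankel form at \<open>a\<close> is the integral of the square of the combination of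
  walk functions with coefficients \<open>a i\<close>.\<close>

lemma moment_sequence_path_density:
  assumes "sym_kernel W" shows "moment_sequence (path_density W)"
  unfolding moment_sequence_def
proof (intro conjI allI path_density_0)
  fix a :: "nat \<Rightarrow> real" and n
  have W2: "bdd_meas2 W" using assms by (simp add: sym_kernel_def)
  have "0 \<le> (\<integral>x. (\<Sum>i\<le>n. a i * walk W i x)\<^sup>2 \<partial>M)"
    by simp
  also have "\<dots> = (\<integral>x. (\<Sum>i\<le>n. \<Sum>j\<le>n. a i * a j * (walk W i x * walk W j x)) \<partial>M)"
    by (simp add: power2_eq_square sum_product ac_simps)
  also have "\<dots> = (\<Sum>i\<le>n. \<Sum>j\<le>n. (\<integral>x. a i * a j * (walk W i x * walk W j x) \<partial>M))"
    by (subst Bochner_Integration.integral_sum;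
        (intro bdd_meas_integrable bdd_meas_sum bdd_meas_mult bdd_meas_const bdd_meas_walk W2)?)+
       auto
  also have "\<dots> = (\<Sum>i\<le>n. \<Sum>j\<le>n. a i * a j * path_density W (i + j))"
    by (simp add: integral_walk_walk[OF assms])
  finally show "0 \<le> (\<Sum>i\<le>n. \<Sum>j\<le>n. a i * a j * path_density W (i + j))" .
qed

text \<open>Cut a walk from \<open>x\<close> at the first edge that takes the constant
  \<open>a\<close>: before it lie n - 1 - i edges of \<open>U\<close>, after it a free walk of
  \<open>i\<close> edges in \<open>V\<close>.\<close>

lemma walk_shift:
  fixes a :: real
  assumes U: "bdd_meas2 U" and x: "x \<in> space M"
  defines "V \<equiv> \<lambda>x y. a + U x y"
  shows "walk V n x = walk U n x + a * (\<Sum>i<n. path_density V i * walk U (n - Suc i) x)"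
  using x
proof (induction n arbitrary: x)
  case (Suc n)
  have V: "bdd_meas2 V" unfolding V_def by (rule bdd_meas2_add_const[OF U])
  have "walk V (Suc n) x = a * path_density V n + kernel_op U (walk V n) x"
    using kernel_op_shift[OF U bdd_meas_walk[OF V] Suc.prems, of a n]
    by (simp add: V_def path_density_def)
  also have "kernel_op U (walk V n) x
      = kernel_op U (\<lambda>x. walk U n x + a * (\<Sum>i<n. path_density V i * walk U (n - Suc i) x)) x"
    by (rule kernel_op_cong) (rule Suc.IH)
  also have "\<dots> = walk U (Suc n) x
      + a * (\<Sum>i<n. path_density V i * walk U (Suc (n - Suc i)) x)"
    using Suc.prems
    by (simp add: kernel_op_add kernel_op_cmult kernel_op_sum U bdd_meas_walk bdd_meas_mult
        bdd_meas_const bdd_meas_sum)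
  also have "(\<Sum>i<n. path_density V i * walk U (Suc (n - Suc i)) x)
      = (\<Sum>i<n. path_density V i * walk U (Suc n - Suc i) x)"
    by (intro sum.cong refl) (simp add: Suc_diff_Suc del: walk_simps)
  finally show ?case by (simp add: algebra_simps del: walk_simps(2))
qed simp

text \<open>Pairing with \<open>walk U j\<close> prolongs the initial piece in \<open>U\<close> by
  \<open>j\<close> edges.\<close>

lemma integral_walk_shift:
  fixes a :: real
  assumes U: "sym_kernel U"
  defines "V \<equiv> \<lambda>x y. a + U x y"
  shows "(\<integral>x. walk V n x * walk U j x \<partial>M)
    = path_density U (n + j) + a * (\<Sum>i<n. path_density V i * path_density U (n - Suc i + j))"
proof -
  have U2: "bdd_meas2 U" using U by (simp add: sym_kernel_def)
  have "(\<integral>x. walk V n x * walk U j x \<partial>M) = (\<integral>x. walk U n x * walk U j x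
      + a * (\<Sum>i<n. path_density V i * (walk U (n - Suc i) x * walk U j x)) \<partial>M)"
    by (intro Bochner_Integration.integral_cong refl)
       (simp add: V_def walk_shift[OF U2] algebra_simps sum_distrib_left)
  also have "\<dots> = (\<integral>x. walk U n x * walk U j x \<partial>M)
      + a * (\<Sum>i<n. path_density V i * (\<integral>x. walk U (n - Suc i) x * walk U j x \<partial>M))"
    by (intro integral_lincomb bdd_meas_mult bdd_meas_walk U2)
  finally show ?thesis by (simp add: integral_walk_walk[OF U])
qed

lemma path_density_shift:
  fixes a :: real
  assumes U: "sym_kernel U"
  defines "V \<equiv> \<lambda>x y. a + U x y"
  shows "path_density V n
    = path_density U n + a * (\<Sum>i<n. path_density V i * path_density U (n - Suc i))"
  using integral_walk_shift[OF U, of a n 0] by (simp add: V_def path_density_def)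

text \<open>The same cut for walks of n + 1 edges from \<open>x\<close> to \<open>y\<close>: the
  free walk in \<open>V\<close> after the first constant edge now ends at \<open>y\<close>.\<close>

lemma kernel_pow_shift:
  fixes a :: real
  assumes U: "sym_kernel U" and xy: "x \<in> space M" "y \<in> space M"
  defines "V \<equiv> \<lambda>x y. a + U x y"
  shows "kernel_pow V n x y = kernel_pow U n x y + a * (\<Sum>i\<le>n. walk V i y * walk U (n - i) x)"
  using xy(2)
proof (induction n arbitrary: y)
  case 0
  then show ?case by (simp add: V_def)
next
  case (Suc n)
  have U2: "bdd_meas2 U" using U by (simp add: sym_kernel_def)
  have V: "bdd_meas2 V" unfolding V_def by (rule bdd_meas2_add_const[OF U2])
  have K: "bdd_meas (kernel_pow U n x)"
    by (intro bdd_meas2_section bdd_meas2_kernel_pow U2 xy(1))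
  have "kernel_pow V (Suc n) x y = kernel_op V (\<lambda>y. kernel_pow U n x y
      + a * (\<Sum>i\<le>n. walk U (n - i) x * walk V i y)) y"
    unfolding kernel_pow_simps by (intro kernel_op_cong) (simp add: Suc.IH ac_simps)
  also have "\<dots> = kernel_op V (kernel_pow U n x) y
      + a * (\<Sum>i\<le>n. walk U (n - i) x * walk V (Suc i) y)"
    using Suc.prems
    by (simp add: kernel_op_add kernel_op_cmult kernel_op_sum V K bdd_meas_walk bdd_meas_mult
        bdd_meas_const bdd_meas_sum)
  \<comment> \<open>The rank-one part supplies the summand with index 0 of the longer sum.\<close>
  also have "kernel_op V (kernel_pow U n x) y = a * walk U (Suc n) x + kernel_pow U (Suc n) x y"
    unfolding V_def kernel_op_shift[OF U2 K Suc.prems] integral_kernel_pow[OF U xy(1)] by simp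
  finally show ?case
    by (simp add: sum.atMost_Suc_shift algebra_simps del: walk_simps(2) sum.atMost_Suc)
qed

text \<open>The index \<open>l\<close> occurs for the n - l values of \<open>i\<close> with l < i
  \<le> n.\<close>

lemma sum_sum_lessThan: "(\<Sum>i\<le>n. \<Sum>l<i. f l) = (\<Sum>l<n. real (n - l) * f l)"
proof (induction n)
  case (Suc n)
  have "(\<Sum>l<Suc n. real (Suc n - l) * f l) = (\<Sum>l<Suc n. real (n - l) * f l + f l)"
    by (intro sum.cong refl) (simp add: Suc_diff_le distrib_right)
  with Suc show ?case by (simp add: sum.distrib)
qed simp

text \<open>Integrate \<open>kernel_pow_shift\<close> over the diagonal and expand each summand by
  \<open>integral_walk_shift\<close>; the length n - 1 - l of the piece in \<open>U\<close> does not
  depend on \<open>i\<close>, so equal terms can be counted.\<close>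

lemma kernel_trace_shift:
  fixes a :: real
  assumes U: "sym_kernel U"
  defines "V \<equiv> \<lambda>x y. a + U x y"
  shows "kernel_trace V n = kernel_trace U n + a * (real (Suc n) * path_density U n)
    + a\<^sup>2 * (\<Sum>l<n. real (n - l) * (path_density V l * path_density U (n - Suc l)))"
proof -
  have U2: "bdd_meas2 U" using U by (simp add: sym_kernel_def)
  have V: "bdd_meas2 V" unfolding V_def by (rule bdd_meas2_add_const[OF U2])
  have "kernel_trace V n
      = (\<integral>x. kernel_pow U n x x + a * (\<Sum>i\<le>n. walk V i x * walk U (n - i) x) \<partial>M)"
    unfolding kernel_trace_def
    by (intro Bochner_Integration.integral_cong refl) (simp add: V_def kernel_pow_shift[OF U])
  also have "\<dots> = kernel_trace U n + a * (\<Sum>i\<le>n. \<integral>x. walk V i x * walk U (n - i) x \<partial>M)"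
    unfolding kernel_trace_def
    using integral_lincomb[of "\<lambda>x. kernel_pow U n x x" "{..n}" "\<lambda>i x. walk V i x * walk U (n - i) x"
        a "\<lambda>_. 1"]
    by (simp add: bdd_meas_mult bdd_meas_walk bdd_meas2_diag bdd_meas2_kernel_pow U2 V)
  also have "(\<Sum>i\<le>n. \<integral>x. walk V i x * walk U (n - i) x \<partial>M)
      = (\<Sum>i\<le>n. path_density U n + a * (\<Sum>l<i. path_density V l * path_density U (n - Suc l)))"
    by (intro sum.cong refl) (auto simp: V_def integral_walk_shift[OF U] intro!: sum.cong)
  also have "\<dots> = real (Suc n) * path_density U n
      + a * (\<Sum>l<n. real (n - l) * (path_density V l * path_density U (n - Suc l)))"
    by (simp only: sum.distrib sum_sum_lessThan sum_distrib_left[symmetric]) simp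
  finally show ?thesis by (simp add: algebra_simps power2_eq_square)
qed

lemma path_density_shift_fps:
  fixes a :: real
  assumes U: "sym_kernel U"
  defines "P \<equiv> Abs_fps (path_density (\<lambda>x y. a + U x y))"
  shows "P = Abs_fps (path_density U) + fps_const a * fps_X * P * Abs_fps (path_density U)"
proof (rule fps_ext)
  fix n show "fps_nth P n = fps_nth (Abs_fps (path_density U)
      + fps_const a * fps_X * P * Abs_fps (path_density U)) n"
  proof (cases n)
    case (Suc k)
    then show ?thesis
      using path_density_shift[OF U, of a n]
      by (simp add: P_def mult.assoc fps_mult_nth[of "Abs_fps _"] atLeast0AtMost lessThan_Suc_atMost)
  qed (simp add: P_def path_density_0)
qed

lemma kernel_trace_shift_fps:
  fixes a :: real
  assumes U: "sym_kernel U"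
  defines "P \<equiv> Abs_fps (path_density (\<lambda>x y. a + U x y))"
  defines "D \<equiv> fps_const a * fps_X * fps_deriv (fps_X * Abs_fps (path_density U))
      * (1 + fps_const a * fps_X * P)"
  shows "kernel_trace (\<lambda>x y. a + U x y) n = kernel_trace U n + fps_nth D (Suc n)"
proof -
  \<comment> \<open>The weights n + 1 and n - l of the trace formula are the factors j + 1 in this
    derivative, at j = n and j = n - 1 - l.\<close>
  define B' where "B' = fps_deriv (fps_X * Abs_fps (path_density U))"
  have B': "fps_nth B' j = real (Suc j) * path_density U j" for j
    by (simp add: B'_def distrib_right)
  have D: "D = fps_X * (fps_const a * B' + fps_const (a\<^sup>2) * (fps_X * (P * B')))"
    unfolding D_def B'_def[symmetric] power2_eq_square fps_const_mult[symmetric]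
    by (simp only: distrib_left mult_1_right mult_1_left ac_simps)
  have "fps_nth D (Suc n) = a * (real (Suc n) * path_density U n)
      + a\<^sup>2 * (\<Sum>l<n. real (n - l) * (path_density (\<lambda>x y. a + U x y) l * path_density U (n - Suc l)))"
  proof (cases n)
    case (Suc k)
    have "fps_nth (P * B') k
        = (\<Sum>l\<le>k. real (n - l) * (path_density (\<lambda>x y. a + U x y) l * path_density U (n - Suc l)))"
      unfolding fps_mult_nth B' atLeast0AtMost
      by (intro sum.cong refl) (simp add: P_def Suc Suc_diff_le)
    then show ?thesis
      by (simp add: D B' Suc lessThan_Suc_atMost)
  qed (simp add: D B')
  then show ?thesis by (simp add: kernel_trace_shift[OF U])
qed

text \<open>The scalar \<open>c\<close> serves both uses: it is 1 for walks from the constant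
  function, and -1 for kernel powers, where the initial section also changes sign.\<close>

lemma kernel_op_pow_uminus:
  "(kernel_op (\<lambda>x y. - W x y) ^^ n) (\<lambda>x. c * f x) = (\<lambda>x. (- 1) ^ n * c * (kernel_op W ^^ n) f x)"
proof (induction n)
  case (Suc n)
  have "kernel_op (\<lambda>x y. - W x y) f x = - kernel_op W f x" for f x
    by (simp add: kernel_op_def)
  then have neg: "kernel_op (\<lambda>x y. - W x y) f = (\<lambda>x. - kernel_op W f x)" for f
    by blast
  show ?case
    unfolding funpow.simps o_apply Suc unfolding neg kernel_op_cmult by simp
qed simp

lemma path_density_uminus: "path_density (\<lambda>x y. - W x y) n = (- 1) ^ n * path_density W n"
  using kernel_op_pow_uminus[where W = W and n = n and c = 1 and f = "\<lambda>_. 1"] by (simp add: path_density_def walk_def)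

lemma kernel_trace_uminus:
  "kernel_trace (\<lambda>x y. - W x y) n = (- 1) ^ Suc n * kernel_trace W n"
proof -
  have "kernel_pow (\<lambda>x y. - W x y) n x = (\<lambda>y. (- 1) ^ Suc n * kernel_pow W n x y)" for x
    using kernel_op_pow_uminus[where W = W and n = n and c = "- 1" and f = "W x"] by (simp add: kernel_pow_def)
  then show ?thesis by (simp add: kernel_trace_def)
qed

section \<open>The inequalities for path densities and traces\<close>

lemma sym_kernel_uminus: "sym_kernel U \<Longrightarrow> sym_kernel (\<lambda>x y. - U x y)"
  by (auto simp: sym_kernel_def bdd_meas2_def split_beta')

lemma sym_kernel_add_const: "sym_kernel U \<Longrightarrow> sym_kernel (\<lambda>x y. a + U x y)"
  by (auto simp: sym_kernel_def bdd_meas2_add_const)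

lemma path_density_one_minus:
  assumes W: "sym_kernel W"
  shows "path_density (\<lambda>x y. 1 - W x y) 1 = 1 - path_density W 1"
proof -
  have "path_density (\<lambda>x y. 1 + - W x y) 1 = 1 + path_density (\<lambda>x y. - W x y) 1"
    using path_density_shift[OF sym_kernel_uminus[OF W], of 1 1] by (simp add: path_density_0)
  then show ?thesis by (simp add: path_density_uminus)
qed

text \<open>The two kernels are \<open>1/2 + U\<close> and \<open>1/2 - U\<close>, so in the sum of their densities only the
  terms with an even number of factors \<open>U\<close> survive.\<close>

lemma path_density_ge:
  assumes W: "sym_kernel W"
  shows "path_density W k + path_density (\<lambda>x y. 1 - W x y) k
    \<ge> path_density W 1 ^ k + (1 - path_density W 1) ^ k"
proof -
  define U where "U x y = - (1/2) + W x y" for x y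
  have U: "sym_kernel U" unfolding U_def by (rule sym_kernel_add_const[OF W])
  have W_eq: "W = (\<lambda>x y. 1/2 + U x y)" "(\<lambda>x y. 1 - W x y) = (\<lambda>x y. 1/2 + - U x y)"
    by (auto simp: U_def fun_eq_iff)
  have alt: "Abs_fps (path_density (\<lambda>x y. - U x y)) = alternate (Abs_fps (path_density U))"
    by (rule fps_ext) (simp add: path_density_uminus)
  have "path_density W 1 = 1/2 + path_density U 1"
    using path_density_shift[OF U, of "1/2" 1] by (simp add: W_eq(1) path_density_0)
  then show ?thesis
    using path_coeffs_ge[OF moment_sequence_path_density[OF U] path_density_shift_fps[OF U, of "1/2"]
      path_density_shift_fps[OF sym_kernel_uminus[OF U], of "1/2", unfolded alt], of k]
    by (simp add: W_eq)
qed

text \<open>The cycle length n + 1 is odd, so the traces of \<open>U\<close> and \<open>- U\<close>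
  cancel and only terms determined by path densities of \<open>U\<close> remain.\<close>

lemma kernel_trace_odd_ge:
  assumes W: "sym_kernel W" and n: "even n"
  shows "kernel_trace W n + kernel_trace (\<lambda>x y. 1 - W x y) n
    \<ge> path_density W 1 ^ Suc n + (1 - path_density W 1) ^ Suc n"
proof -
  define U where "U x y = - (1/2) + W x y" for x y
  have U: "sym_kernel U" unfolding U_def by (rule sym_kernel_add_const[OF W])
  have W_eq: "W = (\<lambda>x y. 1/2 + U x y)" "(\<lambda>x y. 1 - W x y) = (\<lambda>x y. 1/2 + - U x y)"
    by (auto simp: U_def fun_eq_iff)
  have alt: "Abs_fps (path_density (\<lambda>x y. - U x y)) = alternate (Abs_fps (path_density U))"
    by (rule fps_ext) (simp add: path_density_uminus)
  have "path_density W 1 = 1/2 + path_density U 1"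
    using path_density_shift[OF U, of "1/2" 1] by (simp add: W_eq(1) path_density_0)
  moreover have "kernel_trace (\<lambda>x y. - U x y) n = - kernel_trace U n"
    using n by (simp add: kernel_trace_uminus)
  ultimately show ?thesis
    using odd_cycle_coeffs_ge[OF moment_sequence_path_density[OF U]
        path_density_shift_fps[OF U, of "1/2"]
        path_density_shift_fps[OF sym_kernel_uminus[OF U], of "1/2", unfolded alt] refl refl,
        of "Suc n"] n
      kernel_trace_shift_fps[OF U, of "1/2" n]
      kernel_trace_shift_fps[OF sym_kernel_uminus[OF U], of "1/2" n, unfolded alt]
    by (simp add: W_eq)
qed

text \<open>With n + 1 = 2(l + 1), the trace is the squared L2 norm of
  \<open>kernel_pow W l\<close>, and the path density is the integral of its squared row integrals.
  Compare row by row by Cauchy-Schwarz.\<close>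

lemma kernel_trace_ge_path_density:
  assumes W: "sym_kernel W" and n: "odd n"
  shows "kernel_trace W n \<ge> path_density W (Suc n)"
proof -
  from n obtain l where l: "n = Suc (l + l)" by (metis Suc_eq_plus1 mult_2 oddE)
  have W2: "bdd_meas2 W" using W by (simp add: sym_kernel_def)
  have K: "bdd_meas2 (kernel_pow W i)" for i by (rule bdd_meas2_kernel_pow[OF W2])
  have "path_density W (Suc n) = (\<integral>x. walk W (Suc l) x * walk W (Suc l) x \<partial>M)"
    unfolding integral_walk_walk[OF W] by (simp add: l)
  also have "\<dots> \<le> kernel_trace W n"
    unfolding kernel_trace_def
  proof (rule integral_mono)
    fix x assume x: "x \<in> space M"
    have int: "integrable M (\<lambda>y. (kernel_pow W l x y)\<^sup>2)" "integrable M (kernel_pow W l x)"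
      unfolding power2_eq_square
      by (intro bdd_meas_integrable bdd_meas_mult bdd_meas2_section K x)+
    \<comment> \<open>One of the 2l + 1 applications is written out as the integral against
      \<open>W x\<close>; \<open>l\<close> of the others then move onto \<open>W x\<close> by
      self-adjointness.\<close>
    have "kernel_pow W n x x = (\<integral>y. W x y * (kernel_op W ^^ l) (kernel_pow W l x) y \<partial>M)"
      by (simp add: l kernel_op_def[of W _ x]) (simp add: kernel_pow_def funpow_add)
    also have "\<dots> = (\<integral>y. (kernel_pow W l x y)\<^sup>2 \<partial>M)"
      by (subst kernel_op_pow_selfadjoint[symmetric])
         (auto simp: W W2 K x bdd_meas2_section power2_eq_square simp flip: kernel_pow_def)
    finally have "kernel_pow W n x x = (\<integral>y. (kernel_pow W l x y)\<^sup>2 \<partial>M)" .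
    \<comment> \<open>This is nonnegativity of the variance of a row.\<close>
    moreover have "(\<integral>y. kernel_pow W l x y \<partial>M)\<^sup>2 \<le> (\<integral>y. (kernel_pow W l x y)\<^sup>2 \<partial>M)"
      using variance_positive[of "kernel_pow W l x"] variance_eq[OF int(2,1)] by simp
    ultimately show "walk W (Suc l) x * walk W (Suc l) x \<le> kernel_pow W n x x"
      unfolding integral_kernel_pow[OF W x] by (simp add: power2_eq_square)
  qed (intro bdd_meas_integrable bdd_meas_mult bdd_meas_walk bdd_meas2_diag K W2)+
  finally show ?thesis .
qed

lemma sym_kernel_one_minus: "sym_kernel W \<Longrightarrow> sym_kernel (\<lambda>x y. 1 - W x y)"
  using sym_kernel_add_const[OF sym_kernel_uminus, of W 1] by simp

lemma kernel_trace_ge: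
  assumes W: "sym_kernel W"
  shows "kernel_trace W n + kernel_trace (\<lambda>x y. 1 - W x y) n
    \<ge> path_density W 1 ^ Suc n + (1 - path_density W 1) ^ Suc n"
proof (cases "even n")
  \<comment> \<open>The cycle length is even: each of the two kernels is compared with the path of n
    + 1 edges.\<close>
  case False
  then show ?thesis
    using kernel_trace_ge_path_density[OF W, of n] path_density_ge[OF W, of "Suc n"]
      kernel_trace_ge_path_density[OF sym_kernel_one_minus[OF W], of n] by simp
qed (rule kernel_trace_odd_ge[OF W])

end

subsection \<open>Homomorphism densities as iterated integrals\<close>

text \<open>Recursion on the list lets the variable of the head vertex be integrated out
  first.\<close>

fun chain :: "('a \<Rightarrow> 'a \<Rightarrow> real) \<Rightarrow> ('v \<Rightarrow> 'a) \<Rightarrow> 'v list \<Rightarrow> real" where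
  "chain W x (u # v # vs) = W (x u) (x v) * chain W x (v # vs)"
| "chain W x vs = 1"

lemma chain_cong: "(\<And>v. v \<in> set vs \<Longrightarrow> x v = y v) \<Longrightarrow> chain W x vs = chain W y vs"
  by (induction W x vs rule: chain.induct) auto

lemma chain_eq_prod:
  "chain W x vs = (\<Prod>i<length vs - 1. W (x (vs ! i)) (x (vs ! Suc i)))"
proof (induction W x vs rule: chain.induct)
  case (1 W x u v vs)
  then show ?case by (simp add: prod.lessThan_Suc_shift del: prod.lessThan_Suc)
qed auto

context prob_space
begin

lemma bdd_meas_PiM_pair:
  assumes "bdd_meas2 K" "u \<in> I" "v \<in> I"
  shows "prob_space.bdd_meas (PiM I (\<lambda>_. M)) (\<lambda>x. K (x u) (x v))"
proof -
  interpret P: prob_space "PiM I (\<lambda>_. M)"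
    by (rule prob_space_PiM) (rule prob_space_axioms)
  have "(\<lambda>x. K (x u) (x v)) \<in> borel_measurable (PiM I (\<lambda>_. M))"
    by (intro bdd_meas2_compose[OF assms(1)] measurable_component_singleton assms)
  moreover obtain C where "\<And>x y. x \<in> space M \<Longrightarrow> y \<in> space M \<Longrightarrow> \<bar>K x y\<bar> \<le> C"
    using assms(1) by (metis bdd_meas2_bound)
  then have "\<forall>x\<in>space (PiM I (\<lambda>_. M)). \<bar>K (x u) (x v)\<bar> \<le> C"
    using assms by (auto simp: space_PiM PiE_def Pi_def)
  ultimately show ?thesis unfolding P.bdd_meas_def by blast
qed

lemma bdd_meas_chain:
  assumes "bdd_meas2 W" "set vs \<subseteq> I"
  shows "prob_space.bdd_meas (PiM I (\<lambda>_. M)) (\<lambda>x. chain W x vs)"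
proof -
  interpret P: prob_space "PiM I (\<lambda>_. M)"
    by (rule prob_space_PiM) (rule prob_space_axioms)
  show ?thesis
    using assms(2)
  proof (induction vs)
    case (Cons u vs)
    then show ?case
      by (cases vs) (auto intro!: P.bdd_meas_const P.bdd_meas_mult bdd_meas_PiM_pair assms(1))
  qed (auto intro: P.bdd_meas_const)
qed

text \<open>The kernel \<open>K\<close> joins the two ends: K = 1 gives a path and K = W a cycle.
  Integrating out the head vertex replaces each section \<open>K y\<close> by
  \<open>kernel_op W (K y)\<close>.\<close>

lemma integral_chain:
  assumes W: "sym_kernel W" and K: "bdd_meas2 K" and vs: "distinct (u # vs)"
  shows "(\<integral>x. K (x (last (u # vs))) (x u) * chain W x (u # vs) \<partial>PiM (set (u # vs)) (\<lambda>_. M))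
    = (\<integral>y. (kernel_op W ^^ length vs) (K y) y \<partial>M)"
  using K vs
proof (induction vs arbitrary: u K)
  case Nil
  interpret product_sigma_finite "\<lambda>_. M"
    by (simp add: product_sigma_finite_def sigma_finite_measure_axioms)
  have "(\<lambda>y. K y y) \<in> borel_measurable M"
    by (rule bdd_measD) (rule bdd_meas2_diag[OF Nil(1)])
  from product_integral_singleton[OF this, of u] show ?case by simp
next
  case (Cons v vs)
  interpret product_sigma_finite "\<lambda>_. M"
    by (simp add: product_sigma_finite_def sigma_finite_measure_axioms)
  interpret P: prob_space "PiM (set (u # v # vs)) (\<lambda>_. M)"
    by (rule prob_space_PiM) (rule prob_space_axioms)
  have W2: "bdd_meas2 W" using W by (simp add: sym_kernel_def)
  define w where "w = last (v # vs)"
  have w: "last (u # v # vs) = w" "w \<in> set (v # vs)" "w \<noteq> u"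
    using Cons.prems(2) last_in_set[of "v # vs"] by (auto simp: w_def)
  let ?F = "\<lambda>x. K (x w) (x u) * chain W x (u # v # vs)"
  have "P.bdd_meas ?F"
    using w by (intro P.bdd_meas_mult bdd_meas_PiM_pair bdd_meas_chain Cons.prems W2) auto
  then have int: "integrable (PiM (insert u (set (v # vs))) (\<lambda>_. M)) ?F"
    using P.bdd_meas_integrable by simp
  have "(\<integral>x. ?F x \<partial>PiM (insert u (set (v # vs))) (\<lambda>_. M))
      = (\<integral>x. (\<integral>y. ?F (x(u := y)) \<partial>M) \<partial>PiM (set (v # vs)) (\<lambda>_. M))"
    by (rule product_integral_insert[OF _ _ int]) (use Cons.prems(2) in auto)
  also have "\<dots> = (\<integral>x. kernel_op W (K (x w)) (x v) * chain W x (v # vs) \<partial>PiM (set (v # vs)) (\<lambda>_. M))"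
  proof (rule Bochner_Integration.integral_cong[OF refl])
    fix x assume "x \<in> space (PiM (set (v # vs)) (\<lambda>_. M))"
    then have xv: "x v \<in> space M" by (auto simp: space_PiM PiE_def Pi_def)
    have ch: "chain W (x(u := y)) (v # vs) = chain W x (v # vs)" for y
      by (rule chain_cong) (use Cons.prems(2) in auto)
    have "(\<integral>y. ?F (x(u := y)) \<partial>M) = (\<integral>y. W (x v) y * K (x w) y * chain W x (v # vs) \<partial>M)"
    proof (rule Bochner_Integration.integral_cong[OF refl])
      fix y assume "y \<in> space M"
      \<comment> \<open>The chain has the integrated variable first, \<open>kernel_op\<close> has it
        second.\<close>
      then have "W y (x v) = W (x v) y" using W xv by (auto simp: sym_kernel_def)
      then show "?F (x(u := y)) = W (x v) y * K (x w) y * chain W x (v # vs)"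
        using w(3) Cons.prems(2) ch[of y] by auto
    qed
    then show "(\<integral>y. ?F (x(u := y)) \<partial>M) = kernel_op W (K (x w)) (x v) * chain W x (v # vs)"
      by (simp add: kernel_op_def)
  qed
  also have "\<dots> = (\<integral>y. (kernel_op W ^^ length vs) (kernel_op W (K y)) y \<partial>M)"
    using Cons.IH[OF bdd_meas2_kernel_op[OF W2 Cons.prems(1)], of v] Cons.prems(2)
    by (simp add: w_def)
  finally show ?case
    by (simp only: w(1) list.simps(15) list.size(4) add_0_right add_Suc_right funpow_Suc_right o_apply)
qed

text \<open>Both measures agree on rectangles. Hence almost everywhere statements about pairs pull
  back to two distinct coordinates of the cube.\<close>

lemma distr_PiM_pair:
  assumes "i \<in> I" "j \<in> I" "i \<noteq> j"
  shows "distr (PiM I (\<lambda>_. M)) (M \<Otimes>\<^sub>M M) (\<lambda>x. (x i, x j)) = M \<Otimes>\<^sub>M M"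
proof (rule pair_measure_eqI[symmetric])
  interpret product_prob_space "\<lambda>_. M" I
    by (intro product_prob_space.intro product_prob_space_axioms.intro product_sigma_finite.intro)
       (auto intro: sigma_finite_measure_axioms prob_space_axioms)
  have m: "(\<lambda>x. (x i, x j)) \<in> PiM I (\<lambda>_. M) \<rightarrow>\<^sub>M M \<Otimes>\<^sub>M M"
    by (intro measurable_Pair measurable_component_singleton assms)
  fix A B assume AB: "A \<in> sets M" "B \<in> sets M"
  have "emeasure (distr (PiM I (\<lambda>_. M)) (M \<Otimes>\<^sub>M M) (\<lambda>x. (x i, x j))) (A \<times> B)
      = emeasure (PiM I (\<lambda>_. M)) {x \<in> space (PiM I (\<lambda>_. M)). \<forall>k\<in>{i, j}. x k \<in> (if k = i then A else B)}"
    using AB assms by (subst emeasure_distr[OF m]) (auto intro!: arg_cong[where f = "emeasure _"])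
  also have "\<dots> = emeasure M A * emeasure M B"
    using AB assms by (subst emeasure_PiM_Collect) auto
  finally show "emeasure M A * emeasure M B
      = emeasure (distr (PiM I (\<lambda>_. M)) (M \<Otimes>\<^sub>M M) (\<lambda>x. (x i, x j))) (A \<times> B)" by simp
qed (simp_all add: sigma_finite_measure_axioms)

lemma AE_PiM_pair:
  assumes "AE p in M \<Otimes>\<^sub>M M. P (fst p) (snd p)" "i \<in> I" "j \<in> I" "i \<noteq> j"
  shows "AE x in PiM I (\<lambda>_. M). P (x i) (x j)"
proof -
  have "(\<lambda>x. (x i, x j)) \<in> PiM I (\<lambda>_. M) \<rightarrow>\<^sub>M M \<Otimes>\<^sub>M M"
    by (intro measurable_Pair measurable_component_singleton assms)
  from AE_distrD[OF this, of "\<lambda>p. P (fst p) (snd p)", unfolded distr_PiM_pair[OF assms(2-4)],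
      OF assms(1)]
  show ?thesis by simp
qed

end

text \<open>Measurability of \<open>f\<close> is a conclusion here: in the completion it is
  inherited from the almost everywhere equal \<open>g\<close>.\<close>

lemma integral_completion_AE:
  fixes f g :: "'a \<Rightarrow> real"
  assumes ae: "AE x in N. f x = g x" and g: "g \<in> borel_measurable N"
  shows "(\<integral>x. f x \<partial>completion N) = (\<integral>x. g x \<partial>N)"
proof -
  have gc: "g \<in> borel_measurable (completion N)" by (rule measurable_completion[OF g])
  have "f \<in> borel_measurable (completion N)"
  proof (rule measurableI)
    fix S :: "real set" assume "S \<in> sets borel"
    then have "g -` S \<inter> space N \<in> sets (completion N)"
      using measurable_sets[OF gc] by simp
    moreover have "AE x in completion N. x \<in> g -` S \<inter> space N \<longleftrightarrow> x \<in> f -` S \<inter> space N"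
      using ae by (intro AE_completion) (auto elim: eventually_mono)
    ultimately show "f -` S \<inter> space (completion N) \<in> sets (completion N)"
      using completion.in_sets_AE[of "g -` S \<inter> space N" "f -` S \<inter> space N" N] by simp
  qed simp
  then have "(\<integral>x. f x \<partial>completion N) = (\<integral>x. g x \<partial>completion N)"
    by (rule integral_cong_AE[OF _ gc AE_completion[OF ae]])
  then show ?thesis by (simp add: integral_completion[OF g])
qed

section \<open>The unit interval and Borel versions of kernels\<close>

abbreviation unit_measure :: "real measure" where
  "unit_measure \<equiv> restrict_space lborel {0..1}"

interpretation unit: prob_space unit_measure
  by (rule prob_space_restrict_space) auto

lemma space_unit [simp]: "space unit_measure = {0..1}"
  by (simp add: space_restrict_space)

lemma unit_pair_incl: "(\<lambda>p. p) \<in> unit_measure \<Otimes>\<^sub>M unit_measure \<rightarrow>\<^sub>M lborel \<Otimes>\<^sub>M (lborel :: real measure)"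
proof -
  have "(\<lambda>x. x) \<in> unit_measure \<rightarrow>\<^sub>M lborel"
    by (intro measurable_restrict_space1 measurable_ident_sets refl)
  then have "(\<lambda>p. (fst p, snd p)) \<in> unit_measure \<Otimes>\<^sub>M unit_measure \<rightarrow>\<^sub>M lborel \<Otimes>\<^sub>M (lborel :: real measure)"
    by (intro measurable_Pair measurable_compose[OF measurable_fst] measurable_compose[OF measurable_snd])
  then show ?thesis by simp
qed

text \<open>Cover the exceptional set by a Borel null set: almost all of its sections are null, also
  within the unit interval, so it is null for the product measure.\<close>

lemma AE_unit_pair:
  fixes P :: "real \<times> real \<Rightarrow> bool"
  assumes "AE p in lborel. P p"
  shows "AE p in unit_measure \<Otimes>\<^sub>M unit_measure. P p"
proof -
  interpret U: pair_sigma_finite unit_measure unit_measure ..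
  from assms obtain N where N: "{p. \<not> P p} \<subseteq> N" "N \<in> null_sets (lborel \<Otimes>\<^sub>M lborel)"
    unfolding lborel_prod by (auto elim: AE_E simp: null_sets_def)
  have "AE x in lborel. AE y in lborel. (x, y) \<notin> N"
    by (rule lborel_pair.AE_pair) (rule AE_not_in[OF N(2)])
  then have "AE x in unit_measure. AE y in unit_measure. (x, y) \<notin> N"
    by (auto simp: AE_restrict_space_iff elim!: eventually_mono)
  moreover have "{p \<in> space (unit_measure \<Otimes>\<^sub>M unit_measure). p \<notin> N} \<in> sets (unit_measure \<Otimes>\<^sub>M unit_measure)"
  proof -
    have "(\<lambda>p. p) -` N \<inter> space (unit_measure \<Otimes>\<^sub>M unit_measure) \<in> sets (unit_measure \<Otimes>\<^sub>M unit_measure)"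
      using N(2) by (intro measurable_sets[OF unit_pair_incl]) auto
    then have "space (unit_measure \<Otimes>\<^sub>M unit_measure) - N \<inter> space (unit_measure \<Otimes>\<^sub>M unit_measure)
        \<in> sets (unit_measure \<Otimes>\<^sub>M unit_measure)"
      by simp
    moreover have "space (unit_measure \<Otimes>\<^sub>M unit_measure) - N \<inter> space (unit_measure \<Otimes>\<^sub>M unit_measure)
        = {p \<in> space (unit_measure \<Otimes>\<^sub>M unit_measure). p \<notin> N}" by blast
    ultimately show ?thesis by simp
  qed
  ultimately have "AE p in unit_measure \<Otimes>\<^sub>M unit_measure. p \<notin> N"
    by (intro U.AE_pair_measure)
  then show ?thesis
    using N(1) by (auto elim!: eventually_mono)
qed

text \<open>The operator calculus requires measurability for the product sigma-algebra, which a
  Lebesgue measurable kernel has only after a change on a null set.\<close>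

lemma kernel_borel_version:
  assumes W: "is_kernel W"
  obtains V where "unit.sym_kernel V"
    "AE p in unit_measure \<Otimes>\<^sub>M unit_measure. W (fst p) (snd p) = V (fst p) (snd p)"
proof -
  interpret U: pair_sigma_finite unit_measure unit_measure ..
  obtain B where B: "\<And>x y. x \<in> {0..1} \<Longrightarrow> y \<in> {0..1} \<Longrightarrow> \<bar>W x y\<bar> \<le> B"
    using W unfolding is_kernel_def by blast
  have sym: "\<And>x y. x \<in> {0..1} \<Longrightarrow> y \<in> {0..1} \<Longrightarrow> W x y = W y x"
    using W unfolding is_kernel_def by blast
  let ?S = "{0..1} \<times> {0..1} :: (real \<times> real) set"
  have "?S \<in> sets borel" by (intro borel_closed closed_Times) auto
  then have S: "?S \<inter> space lebesgue \<in> sets lebesgue" by simp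
  have "(\<lambda>(x, y). W x y) \<in> borel_measurable (lebesgue_on ?S)"
    using W unfolding is_kernel_def by blast
  then have "(\<lambda>p. indicator ?S p *\<^sub>R (case p of (x, y) \<Rightarrow> W x y)) \<in> borel_measurable lebesgue"
    unfolding borel_measurable_restrict_space_iff[OF S] .
  then obtain g where g: "g \<in> borel_measurable lborel"
      "AE p in lborel. indicator ?S p *\<^sub>R (case p of (x, y) \<Rightarrow> W x y) = g p"
    using completion_ex_borel_measurable_real by blast
  \<comment> \<open>Averaging with the transpose and truncating make \<open>V\<close> symmetric and
    bounded everywhere; almost everywhere they change nothing, since \<open>W\<close> is symmetric
    and bounded by \<open>B\<close>.\<close>
  define V where "V x y = max (- B) (min B ((g (x, y) + g (y, x)) / 2))" for x y
  have gm: "g \<in> borel_measurable (unit_measure \<Otimes>\<^sub>M unit_measure)"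
    using measurable_compose[OF unit_pair_incl, of g borel] g(1) by (simp add: lborel_prod)
  have gm': "(\<lambda>p. g (snd p, fst p)) \<in> borel_measurable (unit_measure \<Otimes>\<^sub>M unit_measure)"
    using measurable_compose[OF measurable_pair_swap' gm] by (simp add: split_beta')
  have "case_prod V \<in> borel_measurable (unit_measure \<Otimes>\<^sub>M unit_measure)"
    unfolding V_def split_beta' prod.collapse
    by (intro borel_measurable_max borel_measurable_min borel_measurable_const
        borel_measurable_divide borel_measurable_add gm gm')
  moreover have "B \<ge> 0" using B[of 0 0] by auto
  then have "\<bar>V x y\<bar> \<le> B" for x y by (auto simp: V_def)
  ultimately have V: "unit.sym_kernel V"
    unfolding unit.sym_kernel_def unit.bdd_meas2_def by (auto simp: V_def add.commute)
  have ae: "AE p in unit_measure \<Otimes>\<^sub>M unit_measure. W (fst p) (snd p) = g p"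
    using AE_unit_pair[OF g(2)] AE_space
    by eventually_elim (auto simp: space_pair_measure indicator_def split_beta' split: if_splits)
  \<comment> \<open>Swapping coordinates preserves the product measure, so the transpose of
    \<open>g\<close> is also a version of \<open>W\<close>.\<close>
  have "AE p in distr (unit_measure \<Otimes>\<^sub>M unit_measure) (unit_measure \<Otimes>\<^sub>M unit_measure)
      (\<lambda>(x, y). (y, x)). W (fst p) (snd p) = g p"
    unfolding U.distr_pair_swap[symmetric] by (rule ae)
  from AE_distrD[OF measurable_pair_swap' this]
  have ae': "AE p in unit_measure \<Otimes>\<^sub>M unit_measure. W (snd p) (fst p) = g (snd p, fst p)"
    by (simp only: split_beta' fst_conv snd_conv)
  have "AE p in unit_measure \<Otimes>\<^sub>M unit_measure. W (fst p) (snd p) = V (fst p) (snd p)"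
    using ae ae' AE_space
  proof eventually_elim
    case (elim p)
    then have "fst p \<in> {0..1}" "snd p \<in> {0..1}" by (auto simp: space_pair_measure)
    with elim sym[of "fst p" "snd p"] B[of "fst p" "snd p"] show ?case
      by (auto simp: V_def)
  qed
  with V show ?thesis by (rule that)
qed

text \<open>Almost everywhere all of the finitely many factors may be taken from \<open>V\<close>;
  the injective enumeration turns the product over edges into one over indices.\<close>

lemma hom_density_eq:
  fixes s t :: "nat \<Rightarrow> 'v"
  assumes W: "is_kernel W"
    and ae: "AE p in unit_measure \<Otimes>\<^sub>M unit_measure. W (fst p) (snd p) = V (fst p) (snd p)"
    and E: "edges H = (\<lambda>i. {s i, t i}) ` {..<n}" "inj_on (\<lambda>i. {s i, t i}) {..<n}"
    and st: "\<And>i. i < n \<Longrightarrow> s i \<in> verts H \<and> t i \<in> verts H \<and> s i \<noteq> t i"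
    and G: "G \<in> borel_measurable (PiM (verts H) (\<lambda>_. unit_measure))"
      "\<And>x. G x = (\<Prod>i<n. V (x (s i)) (x (t i)))"
  shows "hom_density H W = (\<integral>x. G x \<partial>PiM (verts H) (\<lambda>_. unit_measure))"
  unfolding hom_density_def cube_measure_def
proof (rule integral_completion_AE[OF _ G(1)])
  have "AE x in PiM (verts H) (\<lambda>_. unit_measure). \<forall>i\<in>{..<n}. W (x (s i)) (x (t i)) = V (x (s i)) (x (t i))"
    using st by (intro AE_finite_allI unit.AE_PiM_pair[OF ae]) auto
  then show "AE x in PiM (verts H) (\<lambda>_. unit_measure). (\<Prod>e\<in>edges H. edge_value W x e) = G x"
    using AE_space
  proof eventually_elim
    case (elim x)
    have "(\<Prod>e\<in>edges H. edge_value W x e) = (\<Prod>i<n. edge_value W x {s i, t i})"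
      unfolding E(1) by (subst prod.reindex[OF E(2)]) simp
    also have "\<dots> = G x"
      unfolding G(2)
    proof (rule prod.cong[OF refl])
      fix i assume i: "i \<in> {..<n}"
      have "x (s i) \<in> {0..1}" "x (t i) \<in> {0..1}"
        using elim(2) st[of i] i by (auto simp: space_PiM PiE_def Pi_def)
      then show "edge_value W x {s i, t i} = V (x (s i)) (x (t i))"
        using edge_value_doubleton[OF W, of x "s i" "t i"] elim(1) i by simp
    qed
    finally show ?case .
  qed
qed

section \<open>Paths and cycles as walk densities and traces\<close>

lemma hom_density_path:
  assumes W: "is_kernel W" and V: "unit.sym_kernel V"
    and ae: "AE p in unit_measure \<Otimes>\<^sub>M unit_measure. W (fst p) (snd p) = V (fst p) (snd p)"
    and H: "path_graph H"
  shows "hom_density H W = unit.path_density V (card (edges H))"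
proof -
  from H obtain vs where vs: "vs \<noteq> []" "distinct vs" "verts H = set vs"
      "edges H = {{vs ! i, vs ! Suc i} | i. Suc i < length vs}"
    unfolding path_graph_def by blast
  from vs(1) obtain u us where us: "vs = u # us" by (cases vs) auto
  define n where "n = length us"
  have n: "length vs = Suc n" by (simp add: us n_def)
  let ?e = "\<lambda>i. {vs ! i, vs ! Suc i}"
  have V2: "unit.bdd_meas2 V" using V by (simp add: unit.sym_kernel_def)
  have E: "edges H = ?e ` {..<n}"
    unfolding vs(4) by (auto simp: n)
  have inj: "inj_on ?e {..<n}"
    using vs(2) by (auto simp: inj_on_def doubleton_eq_iff nth_eq_iff_index_eq n)
  have "hom_density H W = (\<integral>x. chain V x vs \<partial>PiM (verts H) (\<lambda>_. unit_measure))"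
  proof (rule hom_density_eq[OF W ae E inj])
    show "vs ! i \<in> verts H \<and> vs ! Suc i \<in> verts H \<and> vs ! i \<noteq> vs ! Suc i" if "i < n" for i
      using that vs(2,3) by (auto simp: nth_eq_iff_index_eq n)
    interpret P: prob_space "PiM (verts H) (\<lambda>_. unit_measure)"
      by (rule prob_space_PiM) (rule unit.prob_space_axioms)
    show "(\<lambda>x. chain V x vs) \<in> borel_measurable (PiM (verts H) (\<lambda>_. unit_measure))"
      using vs by (intro P.bdd_measD unit.bdd_meas_chain V2) simp
    show "chain V x vs = (\<Prod>i<n. V (x (vs ! i)) (x (vs ! Suc i)))" for x
      unfolding chain_eq_prod by (simp add: n)
  qed
  \<comment> \<open>The joining kernel is the constant 1, so the path stays open.\<close>
  also have "\<dots> = unit.path_density V n"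
    using unit.integral_chain[OF V unit.bdd_meas2_fst[OF unit.bdd_meas_const[of 1]], of u us] vs
    by (simp add: us n_def unit.path_density_def unit.walk_def)
  also have "n = card (edges H)"
    unfolding E using inj by (simp add: card_image)
  finally show ?thesis .
qed

lemma hom_density_cycle:
  assumes W: "is_kernel W" and V: "unit.sym_kernel V"
    and ae: "AE p in unit_measure \<Otimes>\<^sub>M unit_measure. W (fst p) (snd p) = V (fst p) (snd p)"
    and H: "cycle_graph H"
  shows "hom_density H W = unit.kernel_trace V (card (edges H) - 1) \<and> card (edges H) > 0"
proof -
  from H obtain vs where vs: "length vs \<ge> 3" "distinct vs" "verts H = set vs"
      "edges H = {{vs ! i, vs ! (Suc i mod length vs)} | i. i < length vs}"
    unfolding cycle_graph_def by blast
  from vs(1) obtain u us where us: "vs = u # us" by (cases vs) auto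
  define n where "n = length us"
  have n: "length vs = Suc n" "n \<ge> 2" using vs(1) by (auto simp: us n_def)
  let ?e = "\<lambda>i. {vs ! i, vs ! (Suc i mod Suc n)}"
  have V2: "unit.bdd_meas2 V" using V by (simp add: unit.sym_kernel_def)
  have E: "edges H = ?e ` {..<Suc n}"
    unfolding vs(4) n by auto
  have inj: "inj_on ?e {..<Suc n}"
  proof (rule inj_onI)
    fix i j assume ij: "i \<in> {..<Suc n}" "j \<in> {..<Suc n}" "?e i = ?e j"
    have "Suc i mod Suc n < Suc n" "Suc j mod Suc n < Suc n" by simp_all
    \<comment> \<open>The second alternative makes \<open>i\<close> and \<open>j\<close> successors
      of each other, which is impossible on a cycle of at least three vertices.\<close>
    then have "i = j \<or> (i = Suc j mod Suc n \<and> Suc i mod Suc n = j)"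
      using ij vs(2) n by (auto simp: doubleton_eq_iff nth_eq_iff_index_eq)
    then show "i = j"
      using ij n(2) by (auto simp: mod_Suc split: if_splits)
  qed
  \<comment> \<open>The closing edge runs from the last vertex to the first, as the factor
    \<open>K\<close> does in \<open>integral_chain\<close>.\<close>
  let ?G = "\<lambda>x. V (x (last vs)) (x u) * chain V x vs"
  have "hom_density H W = (\<integral>x. ?G x \<partial>PiM (verts H) (\<lambda>_. unit_measure))"
  proof (rule hom_density_eq[OF W ae E inj])
    show "vs ! i \<in> verts H \<and> vs ! (Suc i mod Suc n) \<in> verts H \<and> vs ! i \<noteq> vs ! (Suc i mod Suc n)"
      if i: "i < Suc n" for i
    proof -
      have "Suc i mod Suc n < Suc n" "i \<noteq> Suc i mod Suc n"
        using i n(2) by (auto simp: mod_Suc)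
      then show ?thesis
        using i vs(2,3) n by (simp add: nth_eq_iff_index_eq)
    qed
    interpret P: prob_space "PiM (verts H) (\<lambda>_. unit_measure)"
      by (rule prob_space_PiM) (rule unit.prob_space_axioms)
    show "?G \<in> borel_measurable (PiM (verts H) (\<lambda>_. unit_measure))"
      using vs by (intro P.bdd_measD P.bdd_meas_mult unit.bdd_meas_PiM_pair unit.bdd_meas_chain V2)
        (auto simp: us)
    show "?G x = (\<Prod>i<Suc n. V (x (vs ! i)) (x (vs ! (Suc i mod Suc n))))" for x
    proof -
      have "last vs = vs ! n" "u = vs ! 0"
        using n by (simp_all add: us last_conv_nth n_def)
      moreover have "chain V x vs = (\<Prod>i<n. V (x (vs ! i)) (x (vs ! (Suc i mod Suc n))))"
        unfolding chain_eq_prod n by (intro prod.cong) auto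
      ultimately show ?thesis by simp
    qed
  qed
  also have "\<dots> = unit.kernel_trace V n"
    using unit.integral_chain[OF V V2, of u us] vs
    by (simp add: us n_def unit.kernel_trace_def unit.kernel_pow_def)
  also have "n = card (edges H) - 1"
    unfolding E using inj by (simp add: card_image)
  finally show ?thesis
    using inj by (simp add: E card_image)
qed

lemma is_kernel_one_minus:
  assumes "is_kernel W" shows "is_kernel (\<lambda>x y. 1 - W x y)"
proof -
  obtain B where "\<And>x y. x \<in> {0..1} \<Longrightarrow> y \<in> {0..1} \<Longrightarrow> \<bar>W x y\<bar> \<le> B"
    using assms unfolding is_kernel_def by blast
  then have "\<forall>x\<in>{0..1}. \<forall>y\<in>{0..1}. \<bar>1 - W x y\<bar> \<le> 1 + B"
    by (smt (verit))
  moreover have "(\<lambda>(x, y). 1 - W x y) = (\<lambda>p. 1 - (case p of (x, y) \<Rightarrow> W x y))"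
    by (simp add: fun_eq_iff)
  ultimately show ?thesis
    using assms unfolding is_kernel_def by auto
qed

text \<open>As a path with one edge, \<open>K2\<close> has its density given by
  \<open>hom_density_path\<close>.\<close>

lemma K2_path: "path_graph K2" "card (edges K2) = 1"
proof -
  have "edges K2 = {{[0, 1] ! i, [0, 1] ! Suc i} | i. Suc i < length [0, 1 :: nat]}"
    by (auto simp: K2_def)
  then show "path_graph K2"
    unfolding path_graph_def by (intro exI[of _ "[0, 1]"]) (auto simp: K2_def)
qed (simp add: K2_def)

theorem theorem1p1:
  fixes H :: "'v ugraph" and W :: "real \<Rightarrow> real \<Rightarrow> real"
  assumes "path_graph H \<or> cycle_graph H"
    and "is_kernel W"
  shows "hom_density H W + hom_density H (\<lambda>x y. 1 - W x y)
    \<ge> hom_density K2 W ^ card (edges H)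
      + hom_density K2 (\<lambda>x y. 1 - W x y) ^ card (edges H)"
proof -
  obtain V where V: "unit.sym_kernel V"
    and ae: "AE p in unit_measure \<Otimes>\<^sub>M unit_measure. W (fst p) (snd p) = V (fst p) (snd p)"
    using kernel_borel_version[OF assms(2)] by blast
  let ?W' = "\<lambda>x y. 1 - W x y" and ?V' = "\<lambda>x y. 1 - V x y"
  have W': "is_kernel ?W'" by (rule is_kernel_one_minus[OF assms(2)])
  have V': "unit.sym_kernel ?V'" by (rule unit.sym_kernel_one_minus[OF V])
  have ae': "AE p in unit_measure \<Otimes>\<^sub>M unit_measure. ?W' (fst p) (snd p) = ?V' (fst p) (snd p)"
    using ae by eventually_elim simp
  have K2: "hom_density K2 W = unit.path_density V 1"
    "hom_density K2 ?W' = 1 - unit.path_density V 1"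
    using hom_density_path[OF assms(2) V ae K2_path(1)] hom_density_path[OF W' V' ae' K2_path(1)]
      unit.path_density_one_minus[OF V] by (simp_all add: K2_path(2))
  from assms(1) show ?thesis
  proof
    assume H: "path_graph H"
    show ?thesis
      unfolding K2 hom_density_path[OF assms(2) V ae H] hom_density_path[OF W' V' ae' H]
      by (rule unit.path_density_ge[OF V])
  next
    assume H: "cycle_graph H"
    \<comment> \<open>The trace is indexed by the number of edges minus one; as this number is
      positive, the exponent \<open>Suc (card (edges H) - 1)\<close> is the number of edges.\<close>
    then show ?thesis
      using hom_density_cycle[OF assms(2) V ae H] hom_density_cycle[OF W' V' ae' H]
        unit.kernel_trace_ge[OF V, of "card (edges H) - 1"]
      by (simp add: K2)
  qed
qed

end
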